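(* Suppose that (S1), (S2), (S3) and (M3) are fulfilled for some $q\ge2$, that $K$ satisfies the kernel assumption and that $K$ is symmetric. Then, as $n\to\infty$, $b=b_n\to0$, $nb\to\infty$, $$\sup_{u\in[\frac b2,1-\frac b2]}\Big\|\frac1n\sum_{t=1}^nK_b\big(\tfrac tn-u\big)\{X_{t,n}-\tilde X_t(u)\}\Big\|_q=o(b)+O(n^{-1}).$$
   Context: $\|W\|_q:=(\mathbb{E}|W|^q)^{1/q}$; $K_b(x):=\frac1bK(\frac xb)$. $(X_{t,n})_{t=1,\dots,n}$, $n\in\mathbb{N}$, is a triangular array of real random variables, and for each $u\in[0,1]$, $(\tilde X_t(u))_{t\in\mathbb{Z}}$ is a stationary and ergodic real process on the same probability space. (S1) $\sup_{u\in[0,1]}\|\tilde X_t(u)\|_q<\infty$, and there are $0<\alpha\le1$, $C_B>0$ such that uniformly in $t=1,\dots,n$ and $u,v\in[0,1]$: $\|\tilde X_t(u)-\tilde X_t(v)\|_q\le C_B|u-v|^\alpha$ and $\|X_{t,n}-\tilde X_t(t/n)\|_q\le C_Bn^{-\alpha}$. (S2) $u\mapsto\tilde X_t(u)$ is a.s. continuous for all $t\in\mathbb{Z}$ and $\|\sup_{u\in[0,1]}|\tilde X_t(u)|\|_q<\infty$. (S3) In (S1) $\alpha=1$; $u\mapsto\tilde X_t(u)$ is a.s. continuously differentiable for all $t\in\mathbb{Z}$ and $\|\sup_{u\in[0,1]}|\partial_u\tilde X_t(u)|\|_q<\infty$. Dependence measure: $(\varepsilon_t)_{t\in\mathbb{Z}}$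 are i.i.d. random variables, $\mathcal{F}_t:=(\varepsilon_t,\varepsilon_{t-1},\dots)$, and $\mathcal{F}_t^{*(t-k)}$ is $\mathcal{F}_t$ with $\varepsilon_{t-k}$ replaced by $\varepsilon_{t-k}^*$, which has the same distribution as $\varepsilon_1$ and is independent of all $\varepsilon_s$. For $W_t=H_t(\mathcal{F}_t)$ with $H_t$ measurable put $W_t^{*(t-k)}:=H_t(\mathcal{F}_t^{*(t-k)})$ and $\delta_q^W(k):=\sup_t\|W_t-W_t^{*(t-k)}\|_q$. (M3) With measurable functions $H(u,\cdot)$ such that $\tilde X_t(u)=H(u,\mathcal{F}_t)$, one has $\partial_u\tilde X_t(u)=\partial_uH(u,\mathcal{F}_t)$ and $\sum_{k\ge0}\sup_{u\in[0,1]}\delta_q^{\partial_u\tilde X(u)}(k)<\infty$. Kernel assumption: $K:\mathbb{R}\to\mathbb{R}$ is bounded, of bounded variation, with compact support $[-\frac12,\frac12]$ and $\int K\,dx=1$. *)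

theory Defs
  imports "HOL-Probability.Probability" "HOL-Library.Landau_Symbols"
begin

text \<open>
  Norms take values in \<^typ>\<open>ennreal\<close>, so that a random variable outside \<open>L\<^sup>q\<close> has norm \<open>\<infinity>\<close>.
  The separate \<open>\<infinity>\<close> case is needed since \<open>enn2real \<infinity> = 0\<close>.
\<close>

definition Lq_norm :: "'a measure \<Rightarrow> real \<Rightarrow> ('a \<Rightarrow> real) \<Rightarrow> ennreal" where
  "Lq_norm M q W =
     (let I = (\<integral>\<^sup>+\<omega>. ennreal (\<bar>W \<omega>\<bar> powr q) \<partial>M)
      in if I = \<infinity> then \<infinity> else ennreal (enn2real I powr (1 / q)))"

definition K_scaled :: "(real \<Rightarrow> real) \<Rightarrow> real \<Rightarrow> real \<Rightarrow> real" where
  "K_scaled K b x = 1 / b * K (x / b)"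

definition bounded_variation :: "(real \<Rightarrow> real) \<Rightarrow> bool" where
  "bounded_variation f \<longleftrightarrow>
     (\<exists>V. \<forall>(N::nat) x. mono_on {..N} x \<longrightarrow> (\<Sum>i<N. \<bar>f (x (Suc i)) - f (x i)\<bar>) \<le> V)"

definition kernel_assumption :: "(real \<Rightarrow> real) \<Rightarrow> bool" where
  "kernel_assumption K \<longleftrightarrow>
     bounded (range K) \<and> bounded_variation K \<and> (\<forall>x. x \<notin> {-1/2..1/2} \<longrightarrow> K x = 0) \<and>
     integrable lborel K \<and> (LINT x|lborel. K x) = 1"

abbreviation path_space :: "(int \<Rightarrow> real) measure" where
  "path_space \<equiv> Pi\<^sub>M UNIV (\<lambda>_. borel)"

abbreviation past_space :: "(nat \<Rightarrow> real) measure" where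
  "past_space \<equiv> Pi\<^sub>M UNIV (\<lambda>_. borel)"

definition stationary :: "'a measure \<Rightarrow> (int \<Rightarrow> 'a \<Rightarrow> real) \<Rightarrow> bool" where
  "stationary M Z \<longleftrightarrow>
     (\<forall>h. distr M path_space (\<lambda>\<omega> t. Z (t + h) \<omega>) = distr M path_space (\<lambda>\<omega> t. Z t \<omega>))"

definition ergodic :: "'a measure \<Rightarrow> (int \<Rightarrow> 'a \<Rightarrow> real) \<Rightarrow> bool" where
  "ergodic M Z \<longleftrightarrow>
     (\<forall>A \<in> sets path_space. (\<lambda>z t. z (t + 1)) -` A = A \<longrightarrow>
        measure M {\<omega> \<in> space M. (\<lambda>t. Z t \<omega>) \<in> A} \<in> {0, 1})"

text \<open>
  \<open>X t n\<close> is the array variable \<open>X\<^sub>t\<^sub>,\<^sub>n\<close>, relevant for \<open>t \<in> {1..n}\<close> only; \<open>Y t u\<close> is the stationary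
  approximation at \<open>u\<close>, relevant for \<open>u \<in> {0..1}\<close> only.
\<close>

definition model ::
    "'a measure \<Rightarrow> (nat \<Rightarrow> nat \<Rightarrow> 'a \<Rightarrow> real) \<Rightarrow> (int \<Rightarrow> real \<Rightarrow> 'a \<Rightarrow> real) \<Rightarrow> bool" where
  "model M X Y \<longleftrightarrow>
     prob_space M \<and>
     (\<forall>n. \<forall>t\<in>{1..n}. X t n \<in> borel_measurable M) \<and>
     (\<forall>u\<in>{0..1}. (\<forall>t. Y t u \<in> borel_measurable M) \<and>
        stationary M (\<lambda>t. Y t u) \<and> ergodic M (\<lambda>t. Y t u))"

definition cond_S1 ::
    "'a measure \<Rightarrow> real \<Rightarrow> real \<Rightarrow> real \<Rightarrow>
     (nat \<Rightarrow> nat \<Rightarrow> 'a \<Rightarrow> real) \<Rightarrow> (int \<Rightarrow> real \<Rightarrow> 'a \<Rightarrow> real) \<Rightarrow> bool" where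
  "cond_S1 M q \<alpha> C X Y \<longleftrightarrow>
     (\<forall>t. (SUP u\<in>{0..1}. Lq_norm M q (Y t u)) < \<infinity>) \<and>
     0 < \<alpha> \<and> \<alpha> \<le> 1 \<and> 0 < C \<and>
     (\<forall>n. \<forall>t\<in>{1..n}.
        (\<forall>u\<in>{0..1}. \<forall>v\<in>{0..1}.
           Lq_norm M q (\<lambda>\<omega>. Y (int t) u \<omega> - Y (int t) v \<omega>) \<le> ennreal (C * \<bar>u - v\<bar> powr \<alpha>)) \<and>
        Lq_norm M q (\<lambda>\<omega>. X t n \<omega> - Y (int t) (real t / real n) \<omega>)
          \<le> ennreal (C * real n powr (- \<alpha>)))"

text \<open>
  The suprema over \<open>u\<close> in the next conditions are suprema of reals; almost surely they are taken
  over bounded sets, by continuity on the compact interval \<open>{0..1}\<close>.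
\<close>

definition cond_S2 :: "'a measure \<Rightarrow> real \<Rightarrow> (int \<Rightarrow> real \<Rightarrow> 'a \<Rightarrow> real) \<Rightarrow> bool" where
  "cond_S2 M q Y \<longleftrightarrow>
     (\<forall>t. (AE \<omega> in M. continuous_on {0..1} (\<lambda>u. Y t u \<omega>)) \<and>
          Lq_norm M q (\<lambda>\<omega>. SUP u\<in>{0..1}. \<bar>Y t u \<omega>\<bar>) < \<infinity>)"

definition du :: "(int \<Rightarrow> real \<Rightarrow> 'a \<Rightarrow> real) \<Rightarrow> int \<Rightarrow> real \<Rightarrow> 'a \<Rightarrow> real" where
  "du Y t u \<omega> = vector_derivative (\<lambda>v. Y t v \<omega>) (at u within {0..1})"

definition cond_S3 :: "'a measure \<Rightarrow> real \<Rightarrow> real \<Rightarrow> (int \<Rightarrow> real \<Rightarrow> 'a \<Rightarrow> real) \<Rightarrow> bool" where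
  "cond_S3 M q \<alpha> Y \<longleftrightarrow>
     \<alpha> = 1 \<and>
     (\<forall>t. (AE \<omega> in M. (\<lambda>v. Y t v \<omega>) differentiable_on {0..1} \<and>
                      continuous_on {0..1} (\<lambda>u. du Y t u \<omega>)) \<and>
          Lq_norm M q (\<lambda>\<omega>. SUP u\<in>{0..1}. \<bar>du Y t u \<omega>\<bar>) < \<infinity>)"

text \<open>
  \<open>e' s\<close> is the copy that replaces \<open>e s\<close>. Given that the \<open>e t\<close> are independent, \<open>e' s\<close> is independent
  of \<open>(e t)\<^sub>t\<close> iff the family \<open>e' s\<close>, \<open>(e t)\<^sub>t\<close> is independent; it is indexed by \<^typ>\<open>int option\<close>, with
  \<open>None\<close> for the copy. No joint law of the different copies is prescribed.
\<close>

definition innovations ::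
    "'a measure \<Rightarrow> (int \<Rightarrow> 'a \<Rightarrow> real) \<Rightarrow> (int \<Rightarrow> 'a \<Rightarrow> real) \<Rightarrow> bool" where
  "innovations M e e' \<longleftrightarrow>
     prob_space.indep_vars M (\<lambda>_. borel) e UNIV \<and>
     (\<forall>t. distr M borel (e t) = distr M borel (e 1)) \<and>
     (\<forall>s. distr M borel (e' s) = distr M borel (e 1) \<and>
          prob_space.indep_vars M (\<lambda>_. borel) (case_option (e' s) e) UNIV)"

definition past :: "(int \<Rightarrow> 'a \<Rightarrow> real) \<Rightarrow> int \<Rightarrow> 'a \<Rightarrow> nat \<Rightarrow> real" where
  "past e t \<omega> = (\<lambda>j. e (t - int j) \<omega>)"

definition past_coupled ::
    "(int \<Rightarrow> 'a \<Rightarrow> real) \<Rightarrow> (int \<Rightarrow> 'a \<Rightarrow> real) \<Rightarrow> int \<Rightarrow> int \<Rightarrow> 'a \<Rightarrow> nat \<Rightarrow> real" where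
  "past_coupled e e' s t \<omega> = past (e(s := e' s)) t \<omega>"

text \<open>\<open>dep_measure M e e' q H k\<close> is the dependence measure \<open>\<delta>\<^sub>q(k)\<close> of \<open>W t = H t (past e t)\<close>.\<close>

definition dep_measure ::
    "'a measure \<Rightarrow> (int \<Rightarrow> 'a \<Rightarrow> real) \<Rightarrow> (int \<Rightarrow> 'a \<Rightarrow> real) \<Rightarrow> real \<Rightarrow>
     (int \<Rightarrow> (nat \<Rightarrow> real) \<Rightarrow> real) \<Rightarrow> nat \<Rightarrow> ennreal" where
  "dep_measure M e e' q H k =
     (SUP t. Lq_norm M q (\<lambda>\<omega>. H t (past e t \<omega>) - H t (past_coupled e e' (t - int k) t \<omega>)))"

text \<open>
  \<open>DH u\<close> is a measurable version of \<open>\<partial>\<^sub>uH(u,\<cdot>)\<close>. The function \<open>H(\<cdot>,x)\<close> need only be differentiable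
  at \<open>u\<close> for almost every realization \<open>x\<close> of the past, so \<open>DH u\<close> is determined up to null sets of
  the law of \<open>past e t\<close>. The coupled past has the same law, so the dependence measure does not
  depend on the choice of the version.
\<close>

definition cond_M3 ::
    "'a measure \<Rightarrow> (int \<Rightarrow> 'a \<Rightarrow> real) \<Rightarrow> (int \<Rightarrow> 'a \<Rightarrow> real) \<Rightarrow> real \<Rightarrow>
     (int \<Rightarrow> real \<Rightarrow> 'a \<Rightarrow> real) \<Rightarrow> bool" where
  "cond_M3 M e e' q Y \<longleftrightarrow>
     (\<exists>H DH :: real \<Rightarrow> (nat \<Rightarrow> real) \<Rightarrow> real.
        (\<forall>u\<in>{0..1}. H u \<in> borel_measurable past_space \<and> DH u \<in> borel_measurable past_space) \<and>
        (\<forall>u\<in>{0..1}. \<forall>t. AE \<omega> in M. Y t u \<omega> = H u (past e t \<omega>)) \<and>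
        (\<forall>u\<in>{0..1}. \<forall>t. AE \<omega> in M.
           ((\<lambda>v. H v (past e t \<omega>)) has_real_derivative DH u (past e t \<omega>)) (at u within {0..1}) \<and>
           du Y t u \<omega> = DH u (past e t \<omega>)) \<and>
        (\<Sum>k. SUP u\<in>{0..1}. dep_measure M e e' q (\<lambda>_. DH u) k) < \<infinity>)"

end

theory Submission
  imports Defs
begin

text \<open>
  Since \<open>n b \<rightarrow> \<infinity>\<close>, an error \<open>O(1/n)\<close> is \<open>o(b)\<close>, so the whole expression is shown to be \<open>o(b)\<close>.
  Put \<open>w\<^sub>t = K\<^sub>b(t/n - u)/n\<close>; these weights have bounded absolute sum. Replacing \<open>X\<^sub>t\<^sub>,\<^sub>n\<close> by its
  stationary approximation at \<open>t/n\<close> costs \<open>O(1/n)\<close>. Replacing the increment of that approximation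
  between \<open>u\<close> and \<open>t/n\<close> by \<open>(t/n - u)\<close> times its derivative at \<open>u\<close> costs \<open>b\<close> times the \<open>L\<^sup>q\<close> norm of
  the modulus of continuity of the derivative process, which tends to \<open>0\<close> by dominated convergence.
  What remains is \<open>b\<close> times an average of the derivatives \<open>D\<^sub>u(\<F>\<^sub>t)\<close> with weights
  \<open>y\<^sub>t K(y\<^sub>t)/(n b)\<close>, \<open>y\<^sub>t = (t/n - u)/b\<close>. The centered part vanishes in \<open>L\<^sup>q\<close> by a law of large
  numbers for functions of the past of an i.i.d. sequence, which needs mixing only and no rate;
  the mean part vanishes because \<open>y K(y)\<close> is odd.
\<close>

text \<open>The kernel weights change with \<open>n\<close> and \<open>u\<close>, and
  \<open>n b\<close> may grow arbitrarily slowly. The law of large numbers is therefore formulated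
  for all finite families of weights at once, restricted only by total mass and largest weight
  (\<open>averages_vanish\<close>). The functions obeying it form a linear class closed in
  \<open>L\<^sup>q\<close>, so centered indicators are enough. The remaining dependence on
  \<open>u\<close>, through \<open>D\<^sub>u\<close>, is removed by compactness of [0,1]. The other
  obstacle is measurability. \<open>D\<^sub>u\<close> agrees with the derivative process for each
  fixed \<open>u\<close> off a null set that depends on \<open>u\<close>, while the smoothness
  condition speaks of whole paths and of a supremum over uncountably many \<open>u\<close>. The
  modulus of continuity over rational points mediates: it is a measurable function of the past, it
  equals the modulus of the path almost surely, and its norm is the same at all times. Norm
  estimates are stated as \<open>Lq_norm M q W \<le> ennreal c\<close> with finite \<open>c\<close>,
  which turns them into estimates of \<open>q\<close>-th moments.\<close>

section \<open>Calculus of \<open>L\<^sup>q\<close> norms\<close>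

lemma Lq_norm_le_iff:
  assumes "0 < q" "0 \<le> c"
  shows "Lq_norm M q W \<le> ennreal c \<longleftrightarrow> (\<integral>\<^sup>+\<omega>. ennreal (\<bar>W \<omega>\<bar> powr q) \<partial>M) \<le> ennreal (c powr q)"
proof -
  define I where "I = (\<integral>\<^sup>+\<omega>. ennreal (\<bar>W \<omega>\<bar> powr q) \<partial>M)"
  show ?thesis
  proof (cases I)
    case (real r)
    have "r powr (1 / q) \<le> c \<longleftrightarrow> r \<le> c powr q"
    proof
      assume "r powr (1 / q) \<le> c"
      then have "(r powr (1 / q)) powr q \<le> c powr q"
        using assms by (intro powr_mono2) auto
      then show "r \<le> c powr q" using assms real by (simp add: powr_powr)
    next
      assume "r \<le> c powr q"
      then have "r powr (1 / q) \<le> (c powr q) powr (1 / q)"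
        using assms real by (intro powr_mono2) auto
      then show "r powr (1 / q) \<le> c" using assms by (simp add: powr_powr)
    qed
    then show ?thesis
      using real assms unfolding Lq_norm_def I_def[symmetric] by (simp add: ennreal_le_iff)
  next
    case top
    then show ?thesis unfolding Lq_norm_def I_def[symmetric] by (simp add: top_unique)
  qed
qed

text \<open>Neither function is assumed measurable: the bound is applied with \<open>g\<close> a
  supremum over uncountably many \<open>u\<close>.\<close>

lemma Lq_norm_mono_AE:
  assumes "0 < q" and "AE \<omega> in M. \<bar>f \<omega>\<bar> \<le> \<bar>g \<omega>\<bar>" and "0 \<le> c" and "Lq_norm M q g \<le> ennreal c"
  shows "Lq_norm M q f \<le> ennreal c"
proof -
  have "(\<integral>\<^sup>+\<omega>. ennreal (\<bar>f \<omega>\<bar> powr q) \<partial>M) \<le> (\<integral>\<^sup>+\<omega>. ennreal (\<bar>g \<omega>\<bar> powr q) \<partial>M)"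
    using assms by (intro nn_integral_mono_AE) (auto elim!: eventually_mono intro!: ennreal_leI powr_mono2)
  then show ?thesis using assms by (simp add: Lq_norm_le_iff)
qed

lemma Lq_norm_distr:
  assumes "T \<in> M \<rightarrow>\<^sub>M N" "f \<in> borel_measurable N"
  shows "Lq_norm (distr M N T) q f = Lq_norm M q (\<lambda>\<omega>. f (T \<omega>))"
  using assms by (simp add: Lq_norm_def nn_integral_distr)

text \<open>For positive arguments this is convexity of the power function. If one argument is 0, it
  reduces to \<open>w powr q \<le> w\<close> for a weight \<open>w\<close> in [0,1].\<close>

lemma powr_convex_combination_le:
  fixes q :: real
  assumes "1 \<le> q" "0 \<le> x" "0 \<le> y" "0 \<le> u" "0 \<le> v" "u + v = 1"
  shows "(u * x + v * y) powr q \<le> u * x powr q + v * y powr q"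
proof -
  have contract: "(w * z) powr q \<le> w * z powr q" if "0 \<le> w" "w \<le> 1" "0 \<le> z" for w z :: real
  proof -
    have "w powr q \<le> w powr 1" using that assms by (intro powr_mono') auto
    then show ?thesis using that by (simp add: powr_mult mult_right_mono)
  qed
  consider "x = 0" | "y = 0" | "x > 0" "y > 0" using assms by linarith
  then show ?thesis
  proof cases
    case 3
    then show ?thesis
      using powr_convex[OF assms(1)] assms by (auto simp: convex_on_def)
  qed (use contract[of u x] contract[of v y] assms in auto)
qed

text \<open>Minkowski's inequality. \<open>(f + g) / (a + b)\<close> is a convex combination of
  \<open>f / a\<close> and \<open>g / b\<close>, whose \<open>q\<close>-th moments are at most 1, so
  by convexity its own moment is at most 1.\<close>

lemma Lq_norm_add:
  assumes q: "1 \<le> q" and [measurable]: "f \<in> borel_measurable M" "g \<in> borel_measurable M"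
    and "0 \<le> a" "0 \<le> b" and "Lq_norm M q f \<le> ennreal a" "Lq_norm M q g \<le> ennreal b"
  shows "Lq_norm M q (\<lambda>\<omega>. f \<omega> + g \<omega>) \<le> ennreal (a + b)"
proof (rule ennreal_le_epsilon)
  have pos: "Lq_norm M q (\<lambda>\<omega>. f \<omega> + g \<omega>) \<le> ennreal (a + b)"
    if "0 < a" "0 < b" and f: "Lq_norm M q f \<le> ennreal a" and g: "Lq_norm M q g \<le> ennreal b" for a b
  proof -
    define s where "s = (a + b) powr q"
    define \<rho> where "\<rho> = a / (a + b)"
    define \<mu> where "\<mu> = b / (a + b)"
    have \<rho>\<mu>: "0 \<le> \<rho>" "0 \<le> \<mu>" "\<rho> + \<mu> = 1"
      using that by (auto simp: \<rho>_def \<mu>_def add_divide_distrib[symmetric])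
    have scaled: "(\<integral>\<^sup>+\<omega>. ennreal (\<bar>h \<omega> / c\<bar> powr q) \<partial>M) \<le> 1"
      if "h \<in> borel_measurable M" "0 < c" "Lq_norm M q h \<le> ennreal c" for h c
    proof -
      note that(1)[measurable]
      have "(\<integral>\<^sup>+\<omega>. ennreal (\<bar>h \<omega> / c\<bar> powr q) \<partial>M)
          = (\<integral>\<^sup>+\<omega>. ennreal (1 / c powr q) * ennreal (\<bar>h \<omega>\<bar> powr q) \<partial>M)"
        using that by (intro nn_integral_cong)
          (simp add: abs_divide powr_divide ennreal_mult[symmetric])
      also have "\<dots> = ennreal (1 / c powr q) * (\<integral>\<^sup>+\<omega>. ennreal (\<bar>h \<omega>\<bar> powr q) \<partial>M)"
        by (rule nn_integral_cmult) measurable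
      also have "\<dots> \<le> ennreal (1 / c powr q) * ennreal (c powr q)"
        using that q by (intro mult_left_mono) (auto simp: Lq_norm_le_iff)
      also have "\<dots> = 1" using that by (simp add: ennreal_mult[symmetric])
      finally show ?thesis .
    qed
    have pw: "\<bar>f \<omega> + g \<omega>\<bar> powr q \<le> s * (\<rho> * \<bar>f \<omega> / a\<bar> powr q + \<mu> * \<bar>g \<omega> / b\<bar> powr q)" for \<omega>
    proof -
      have "\<bar>f \<omega> + g \<omega>\<bar> \<le> (a + b) * (\<rho> * \<bar>f \<omega> / a\<bar> + \<mu> * \<bar>g \<omega> / b\<bar>)"
        using that by (simp add: \<rho>_def \<mu>_def abs_divide distrib_left)
      then have "\<bar>f \<omega> + g \<omega>\<bar> powr q \<le> s * (\<rho> * \<bar>f \<omega> / a\<bar> + \<mu> * \<bar>g \<omega> / b\<bar>) powr q"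
        unfolding s_def powr_mult[symmetric] using q by (intro powr_mono2) auto
      also have "\<dots> \<le> s * (\<rho> * \<bar>f \<omega> / a\<bar> powr q + \<mu> * \<bar>g \<omega> / b\<bar> powr q)"
        using q \<rho>\<mu> by (intro mult_left_mono powr_convex_combination_le) (auto simp: s_def)
      finally show ?thesis .
    qed
    have "(\<integral>\<^sup>+\<omega>. ennreal (\<bar>f \<omega> + g \<omega>\<bar> powr q) \<partial>M)
        \<le> (\<integral>\<^sup>+\<omega>. ennreal s * (ennreal \<rho> * ennreal (\<bar>f \<omega> / a\<bar> powr q)
              + ennreal \<mu> * ennreal (\<bar>g \<omega> / b\<bar> powr q)) \<partial>M)"
      using pw \<rho>\<mu> by (intro nn_integral_mono)
        (simp add: ennreal_mult[symmetric] ennreal_plus[symmetric] s_def del: ennreal_plus)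
    also have "\<dots> = ennreal s * (ennreal \<rho> * (\<integral>\<^sup>+\<omega>. ennreal (\<bar>f \<omega> / a\<bar> powr q) \<partial>M)
              + ennreal \<mu> * (\<integral>\<^sup>+\<omega>. ennreal (\<bar>g \<omega> / b\<bar> powr q) \<partial>M))"
      by (simp add: nn_integral_cmult nn_integral_add)
    also have "\<dots> \<le> ennreal s * (ennreal \<rho> * 1 + ennreal \<mu> * 1)"
      using that by (intro mult_left_mono add_mono scaled) auto
    also have "\<dots> = ennreal s" using \<rho>\<mu> by (simp add: ennreal_plus[symmetric] del: ennreal_plus)
    finally show ?thesis using that q by (simp add: Lq_norm_le_iff s_def del: ennreal_plus)
  qed
  \<comment> \<open>The normalization divides by \<open>a\<close> and \<open>b\<close>, which may be
    0; enlarging each by \<open>\<epsilon> / 2\<close> restores positivity.\<close>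
  fix \<epsilon> :: real assume "0 < \<epsilon>"
  have le: "z \<le> ennreal c \<Longrightarrow> z \<le> ennreal (c + \<epsilon> / 2)" for z c
    using \<open>0 < \<epsilon>\<close> by (elim order_trans) (simp add: ennreal_leI)
  have "Lq_norm M q (\<lambda>\<omega>. f \<omega> + g \<omega>) \<le> ennreal ((a + \<epsilon> / 2) + (b + \<epsilon> / 2))"
    using assms \<open>0 < \<epsilon>\<close> by (intro pos le) auto
  also have "\<dots> = ennreal (a + b) + ennreal \<epsilon>"
    using assms \<open>0 < \<epsilon>\<close> by (simp add: ennreal_plus[symmetric] del: ennreal_plus)
  finally show "Lq_norm M q (\<lambda>\<omega>. f \<omega> + g \<omega>) \<le> ennreal (a + b) + ennreal \<epsilon>" .
qed

lemma Lq_norm_cmult: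
  assumes "0 < q" and [measurable]: "f \<in> borel_measurable M"
    and "0 \<le> a" and "Lq_norm M q f \<le> ennreal a"
  shows "Lq_norm M q (\<lambda>\<omega>. c * f \<omega>) \<le> ennreal (\<bar>c\<bar> * a)"
proof -
  have "(\<integral>\<^sup>+\<omega>. ennreal (\<bar>c * f \<omega>\<bar> powr q) \<partial>M)
      = (\<integral>\<^sup>+\<omega>. ennreal (\<bar>c\<bar> powr q) * ennreal (\<bar>f \<omega>\<bar> powr q) \<partial>M)"
    by (intro nn_integral_cong) (simp add: abs_mult powr_mult ennreal_mult)
  also have "\<dots> = ennreal (\<bar>c\<bar> powr q) * (\<integral>\<^sup>+\<omega>. ennreal (\<bar>f \<omega>\<bar> powr q) \<partial>M)"
    by (rule nn_integral_cmult) measurable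
  also have "\<dots> \<le> ennreal (\<bar>c\<bar> powr q) * ennreal (a powr q)"
    using assms by (intro mult_left_mono) (auto simp: Lq_norm_le_iff)
  also have "\<dots> = ennreal ((\<bar>c\<bar> * a) powr q)" by (simp add: powr_mult ennreal_mult)
  finally show ?thesis using assms by (simp add: Lq_norm_le_iff)
qed

lemma Lq_norm_zero: "Lq_norm M q (\<lambda>_. 0) = 0"
  by (simp add: Lq_norm_def)

lemma (in prob_space) Lq_norm_const:
  assumes "0 < q" shows "Lq_norm M q (\<lambda>_. c) \<le> ennreal \<bar>c\<bar>"
  using assms by (simp add: Lq_norm_le_iff emeasure_space_1)

text \<open>The hypotheses on \<open>Z t\<close> concern nonzero weights only: kernel weights vanish
  outside a window of width \<open>b\<close>, and the Taylor remainder is controlled only inside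
  it.\<close>

lemma Lq_norm_weighted_sum:
  assumes q: "1 \<le> q" and "finite T" "0 \<le> B"
    and "\<And>t. t \<in> T \<Longrightarrow> w t \<noteq> 0 \<Longrightarrow> Z t \<in> borel_measurable M"
    and "\<And>t. t \<in> T \<Longrightarrow> w t \<noteq> 0 \<Longrightarrow> Lq_norm M q (Z t) \<le> ennreal B"
    and S: "(\<Sum>t\<in>T. \<bar>w t\<bar>) \<le> S"
  shows "Lq_norm M q (\<lambda>\<omega>. \<Sum>t\<in>T. w t * Z t \<omega>) \<le> ennreal (S * B)"
proof -
  have "(\<lambda>\<omega>. \<Sum>t\<in>T. w t * Z t \<omega>) \<in> borel_measurable M \<and>
      Lq_norm M q (\<lambda>\<omega>. \<Sum>t\<in>T. w t * Z t \<omega>) \<le> ennreal ((\<Sum>t\<in>T. \<bar>w t\<bar>) * B)"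
    using assms(2,4,5)
  proof (induction T)
    case empty
    then show ?case by (simp add: Lq_norm_zero)
  next
    case (insert t T)
    then have IH: "(\<lambda>\<omega>. \<Sum>t\<in>T. w t * Z t \<omega>) \<in> borel_measurable M"
        "Lq_norm M q (\<lambda>\<omega>. \<Sum>t\<in>T. w t * Z t \<omega>) \<le> ennreal ((\<Sum>t\<in>T. \<bar>w t\<bar>) * B)"
      by auto
    have one: "(\<lambda>\<omega>. w t * Z t \<omega>) \<in> borel_measurable M"
      "Lq_norm M q (\<lambda>\<omega>. w t * Z t \<omega>) \<le> ennreal (\<bar>w t\<bar> * B)"
      using insert.prems[of t] q \<open>0 \<le> B\<close> Lq_norm_cmult[of q "Z t" M B "w t"]
      by (cases "w t = 0"; simp add: Lq_norm_zero)+
    have "Lq_norm M q (\<lambda>\<omega>. w t * Z t \<omega> + (\<Sum>t\<in>T. w t * Z t \<omega>))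
        \<le> ennreal (\<bar>w t\<bar> * B + (\<Sum>t\<in>T. \<bar>w t\<bar>) * B)"
      using \<open>0 \<le> B\<close> by (intro Lq_norm_add q one IH) (auto intro!: mult_nonneg_nonneg sum_nonneg)
    then show ?case using insert.hyps one(1) IH(1) by (simp add: distrib_right)
  qed
  then show ?thesis
    using S \<open>0 \<le> B\<close> by (meson ennreal_leI mult_right_mono order_trans)
qed

text \<open>The bound \<open>a \<le> 1 + a\<^sup>q\<close>, applied to \<open>f / c\<close>, is a cheap substitute for Jensen's inequality.\<close>

lemma (in prob_space) Lq_norm_expectation:
  assumes q: "1 \<le> q" and [measurable]: "f \<in> borel_measurable M"
    and "0 \<le> c" and f: "Lq_norm M q f \<le> ennreal c"
  shows "integrable M f" and "\<bar>expectation f\<bar> \<le> 2 * c"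
proof -
  have L1: "(\<integral>\<^sup>+\<omega>. ennreal \<bar>f \<omega>\<bar> \<partial>M) \<le> ennreal (2 * c)" if "0 < c" "Lq_norm M q f \<le> ennreal c" for c
  proof -
    have pw: "\<bar>x\<bar> \<le> c + c * (1 / c powr q) * \<bar>x\<bar> powr q" for x :: real
    proof -
      have "y \<le> 1 + y powr q" if "0 \<le> y" for y :: real
      proof (cases "y \<le> 1")
        case False
        then have "y powr 1 \<le> y powr q" using q by (intro powr_mono) auto
        then show ?thesis using False by simp
      qed (use powr_ge_zero[of y q] in linarith)
      from this[of "\<bar>x\<bar> / c"] \<open>0 < c\<close> have "c * (\<bar>x\<bar> / c) \<le> c * (1 + (\<bar>x\<bar> / c) powr q)"
        by (intro mult_left_mono) auto
      then show ?thesis using \<open>0 < c\<close> by (simp add: powr_divide distrib_left)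
    qed
    have "(\<integral>\<^sup>+\<omega>. ennreal \<bar>f \<omega>\<bar> \<partial>M)
        \<le> (\<integral>\<^sup>+\<omega>. ennreal c + ennreal (c * (1 / c powr q)) * ennreal (\<bar>f \<omega>\<bar> powr q) \<partial>M)"
      using pw \<open>0 < c\<close> by (intro nn_integral_mono)
        (simp add: ennreal_mult[symmetric] ennreal_plus[symmetric] del: ennreal_plus)
    also have "\<dots> = ennreal c + ennreal (c * (1 / c powr q)) * (\<integral>\<^sup>+\<omega>. ennreal (\<bar>f \<omega>\<bar> powr q) \<partial>M)"
      by (simp add: nn_integral_add nn_integral_cmult emeasure_space_1)
    also have "\<dots> \<le> ennreal c + ennreal (c * (1 / c powr q)) * ennreal (c powr q)"
      using that q by (intro add_mono mult_left_mono) (auto simp: Lq_norm_le_iff)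
    also have "\<dots> = ennreal (2 * c)"
      using \<open>0 < c\<close> by (simp add: ennreal_mult[symmetric] ennreal_plus[symmetric] del: ennreal_plus)
    finally show ?thesis .
  qed
  \<comment> \<open>\<open>L1\<close> divides by its constant, so a possibly zero \<open>c\<close>
    is enlarged, here by 1 and below by \<open>\<epsilon> / 2\<close>.\<close>
  have "Lq_norm M q f \<le> ennreal (c + 1)" using f by (rule order_trans) (simp add: ennreal_leI)
  then have "(\<integral>\<^sup>+\<omega>. ennreal \<bar>f \<omega>\<bar> \<partial>M) \<le> ennreal (2 * (c + 1))" using \<open>0 \<le> c\<close> by (intro L1) auto
  then show int: "integrable M f"
    by (intro integrableI_bounded) (auto simp: less_top[symmetric] top_unique)
  show "\<bar>expectation f\<bar> \<le> 2 * c"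
  proof (rule field_le_epsilon)
    fix \<epsilon> :: real assume "0 < \<epsilon>"
    have "Lq_norm M q f \<le> ennreal (c + \<epsilon> / 2)"
      using f \<open>0 < \<epsilon>\<close> by (elim order_trans) (simp add: ennreal_leI)
    then have "(\<integral>\<^sup>+\<omega>. ennreal \<bar>f \<omega>\<bar> \<partial>M) \<le> ennreal (2 * (c + \<epsilon> / 2))"
      using \<open>0 \<le> c\<close> \<open>0 < \<epsilon>\<close> by (intro L1) auto
    moreover have "(\<integral>\<^sup>+\<omega>. ennreal \<bar>f \<omega>\<bar> \<partial>M) = ennreal (\<integral>\<omega>. \<bar>f \<omega>\<bar> \<partial>M)"
      using int by (intro nn_integral_eq_integral) auto
    ultimately have "(\<integral>\<omega>. \<bar>f \<omega>\<bar> \<partial>M) \<le> 2 * c + \<epsilon>"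
      using \<open>0 \<le> c\<close> \<open>0 < \<epsilon>\<close> by (simp add: ennreal_le_iff distrib_left del: ennreal_plus)
    then show "\<bar>expectation f\<bar> \<le> 2 * c + \<epsilon>" using integral_abs_bound[of M f] by linarith
  qed
qed

lemma Lq_norm_dominated:
  assumes q: "0 < q"
    and [measurable]: "\<And>i::nat. f i \<in> borel_measurable M" "g \<in> borel_measurable M"
    and lim: "AE x in M. (\<lambda>i. f i x) \<longlonglongrightarrow> 0"
    and bound: "\<And>i. AE x in M. \<bar>f i x\<bar> \<le> g x"
    and g: "Lq_norm M q g < \<infinity>" and "0 < \<epsilon>"
  shows "\<exists>N. \<forall>i\<ge>N. Lq_norm M q (f i) \<le> ennreal \<epsilon>"
proof -
  define I where "I i = (\<integral>\<^sup>+x. ennreal (\<bar>f i x\<bar> powr q) \<partial>M)" for i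
  have "I \<longlonglongrightarrow> (\<integral>\<^sup>+x. 0 \<partial>M)"
    unfolding I_def
  proof (rule nn_integral_dominated_convergence)
    show "(\<integral>\<^sup>+x. ennreal (\<bar>g x\<bar> powr q) \<partial>M) < \<infinity>"
      using g by (auto simp: Lq_norm_def Let_def less_top[symmetric] split: if_splits)
    show "AE x in M. ennreal (\<bar>f i x\<bar> powr q) \<le> ennreal (\<bar>g x\<bar> powr q)" for i
      using bound[of i] q by (auto elim!: eventually_mono intro!: ennreal_leI powr_mono2)
    show "AE x in M. (\<lambda>i. ennreal (\<bar>f i x\<bar> powr q)) \<longlonglongrightarrow> 0"
      using lim
    proof eventually_elim
      case (elim x)
      then have "(\<lambda>i. \<bar>f i x\<bar> powr q) \<longlonglongrightarrow> 0"
        using q by (intro tendsto_zero_powrI tendsto_rabs_zero tendsto_const) auto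
      then show ?case using tendsto_ennrealI by fastforce
    qed
  qed measurable
  then have "I \<longlonglongrightarrow> 0" by simp
  then have "\<forall>\<^sub>F i in sequentially. I i < ennreal (\<epsilon> powr q)"
    using \<open>0 < \<epsilon>\<close> by (intro order_tendstoD) auto
  then obtain N where "\<And>i. i \<ge> N \<Longrightarrow> I i < ennreal (\<epsilon> powr q)"
    by (auto simp: eventually_sequentially)
  then show ?thesis
    using q \<open>0 < \<epsilon>\<close> by (auto simp: Lq_norm_le_iff I_def intro: less_imp_le)
qed

section \<open>Mixing of the shift on i.i.d. sequences\<close>

text \<open>Pasts are indexed by the lag, so shifting a past by \<open>k\<close> moves its time back
  by \<open>k\<close> (\<open>shift_past\<close>).\<close>

definition shift :: "nat \<Rightarrow> (nat \<Rightarrow> 'b) \<Rightarrow> nat \<Rightarrow> 'b" where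
  "shift k x = (\<lambda>j. x (j + k))"

lemma measurable_shift [measurable]:
  "shift k \<in> (\<Pi>\<^sub>M i\<in>UNIV. N) \<rightarrow>\<^sub>M (\<Pi>\<^sub>M i\<in>UNIV. N)"
  unfolding shift_def by (rule measurable_PiM_single') (auto simp: space_PiM PiE_iff)

context sequence_space
begin

text \<open>The last hypothesis says that membership in \<open>A\<close> depends on the first
  \<open>k\<close> coordinates only. Splicing two independent sequences at position \<open>k\<close>
  reproduces the law \<open>S\<close>, and under splicing the preimage of the intersection is the
  rectangle \<open>A \<times> B\<close>.\<close>

lemma prob_Int_shift:
  assumes [measurable]: "A \<in> sets S" "B \<in> sets S"
    and A: "\<And>x y. x \<in> space S \<Longrightarrow> y \<in> space S \<Longrightarrow> comb_seq k x y \<in> A \<longleftrightarrow> x \<in> A"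
  shows "P.prob (A \<inter> (shift k -` B \<inter> space S)) = P.prob A * P.prob B"
proof -
  interpret SS: pair_prob_space S S ..
  have "P.prob (A \<inter> (shift k -` B \<inter> space S))
      = measure (distr (S \<Otimes>\<^sub>M S) S (\<lambda>(x, y). comb_seq k x y)) (A \<inter> (shift k -` B \<inter> space S))"
    by (simp add: PiM_comb_seq)
  also have "\<dots> = measure (S \<Otimes>\<^sub>M S)
      ((\<lambda>(x, y). comb_seq k x y) -` (A \<inter> (shift k -` B \<inter> space S)) \<inter> space (S \<Otimes>\<^sub>M S))"
    by (rule measure_distr[OF measurable_comb_seq]) measurable
  also have "(\<lambda>(x, y). comb_seq k x y) -` (A \<inter> (shift k -` B \<inter> space S)) \<inter> space (S \<Otimes>\<^sub>M S) = A \<times> B"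
  proof -
    have "shift k (comb_seq k x y) = y" for x y :: "nat \<Rightarrow> 'a"
      by (simp add: shift_def comb_seq_add)
    moreover have "comb_seq k x y \<in> space S" if "x \<in> space S" "y \<in> space S" for x y
      using that by (auto simp: space_PiM PiE_iff comb_seq_def)
    ultimately show ?thesis
      using A sets.sets_into_space[OF assms(1)] sets.sets_into_space[OF assms(2)]
      by (auto simp: space_pair_measure subset_eq)
  qed
  also have "measure (S \<Otimes>\<^sub>M S) (A \<times> B) = P.prob A * P.prob B"
    by (simp add: measure_def P.emeasure_pair_measure_Times enn2real_mult)
  finally show ?thesis .
qed

lemma prob_shift:
  assumes "B \<in> sets S"
  shows "P.prob (shift k -` B \<inter> space S) = P.prob B"
proof -
  have "P.prob (space S \<inter> (shift k -` B \<inter> space S)) = P.prob (space S) * P.prob B"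
    using assms by (intro prob_Int_shift sets.top) (auto simp: space_PiM PiE_iff comb_seq_def)
  then show ?thesis by (simp add: P.prob_space Int_absorb1)
qed

text \<open>Sets determined by finitely many coordinates are exactly independent of far shifts; the
  asymptotic statement is stable under complements and countable disjoint unions.\<close>

lemma mixing:
  assumes "A \<in> sets S" "0 < \<epsilon>"
  shows "\<exists>m. \<forall>k\<ge>m. \<forall>B\<in>sets S.
    \<bar>P.prob (A \<inter> (shift k -` B \<inter> space S)) - P.prob A * P.prob B\<bar> \<le> \<epsilon>"
proof -
  define C where "C k B = shift k -` B \<inter> space S" for k B
  define d where "d A k B = P.prob (A \<inter> C k B) - P.prob A * P.prob B" for A k B
  have C[measurable]: "C k B \<in> sets S" if "B \<in> sets S" for k B
    using that unfolding C_def by measurable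
  have pC: "P.prob (C k B) = P.prob B" if "B \<in> sets S" for k B
    using prob_shift[OF that] by (simp add: C_def)
  have S: "sets S = sigma_sets (\<Pi>\<^sub>E i\<in>UNIV. space M) (prod_algebra UNIV (\<lambda>i. M))"
    by (rule sets_PiM)
  have "A \<in> sigma_sets (\<Pi>\<^sub>E i\<in>UNIV. space M) (prod_algebra UNIV (\<lambda>i. M))"
    using assms S by simp
  from Int_stable_prod_algebra prod_algebra_sets_into_space this
  \<comment> \<open>With \<open>B\<close> universally quantified, the good sets \<open>A\<close>
    alone form a Dynkin class. The covariances later need \<open>B = A\<close>, a statement that
    would not survive the induction by itself.\<close>
  have "\<forall>\<epsilon>>0. \<exists>m. \<forall>k\<ge>m. \<forall>B\<in>sets S. \<bar>d A k B\<bar> \<le> \<epsilon>"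
  proof (induction rule: sigma_sets_induct_disjoint)
    case (basic A)
    then have "A \<in> sets S" using S by (auto intro: sigma_sets.Basic)
    from basic obtain J E where JE: "A = prod_emb UNIV (\<lambda>i. M) J (Pi\<^sub>E J E)" "finite J"
      "\<And>i. i \<in> J \<Longrightarrow> E i \<in> sets M" by (elim prod_algebraE) auto
    obtain m where m: "\<And>j. j \<in> J \<Longrightarrow> j < m" using \<open>finite J\<close> finite_nat_set_iff_bounded by auto
    have "d A k B = 0" if "k \<ge> m" "B \<in> sets S" for k B
    proof -
      have "comb_seq k x y \<in> A \<longleftrightarrow> x \<in> A" if "x \<in> space S" "y \<in> space S" for x y
        using m \<open>k \<ge> m\<close> that
        by (fastforce simp: JE(1) prod_emb_iff space_PiM PiE_iff comb_seq_def extensional_def)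
      then show ?thesis
        using prob_Int_shift[OF \<open>A \<in> sets S\<close> \<open>B \<in> sets S\<close>, of k] by (simp add: d_def C_def)
    qed
    then show ?case by (intro allI impI exI[of _ m]) auto
  next
    case empty
    then show ?case by (simp add: d_def)
  next
    case (compl A)
    then have [measurable]: "A \<in> sets S" using S by simp
    have "d ((\<Pi>\<^sub>E i\<in>UNIV. space M) - A) k B = - d A k B" if [measurable]: "B \<in> sets S" for k B
    proof -
      have "(space S - A) \<inter> C k B = C k B - A \<inter> C k B" by (auto simp: C_def)
      then have "P.prob ((space S - A) \<inter> C k B) = P.prob B - P.prob (A \<inter> C k B)"
        using pC[OF that] by (simp add: P.finite_measure_Diff)
      then show ?thesis
        using P.prob_compl[of A] by (simp add: d_def space_PiM left_diff_distrib)
    qed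
    then show ?case using compl by simp
  next
    case (union A)
    have A[measurable]: "A i \<in> sets S" for i using union S by auto
    show ?case
    proof (intro allI impI)
      fix \<epsilon> :: real assume "0 < \<epsilon>"
      have sums: "(\<lambda>i. P.prob (A i)) sums P.prob (\<Union>i. A i)"
        using union by (intro P.finite_measure_UNION) auto
      then have "(\<lambda>n. \<Sum>i<n. P.prob (A i)) \<longlonglongrightarrow> P.prob (\<Union>i. A i)" by (simp add: sums_def)
      then obtain n where n: "\<bar>(\<Sum>i<n. P.prob (A i)) - P.prob (\<Union>i. A i)\<bar> < \<epsilon> / 2"
        using \<open>0 < \<epsilon>\<close> LIMSEQ_D[of _ _ "\<epsilon> / 2"] by (metis half_gt_zero le_refl real_norm_def)
      \<comment> \<open>\<open>U\<close> carries all but \<open>\<epsilon> / 2\<close> of the mass.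
        Its \<open>n\<close> pieces are allotted \<open>\<epsilon> / (2 * (n + 1))\<close> each,
        with \<open>n + 1\<close> because \<open>n\<close> may be 0; the remainder \<open>V\<close>
        contributes at most its own probability.\<close>
      define U where "U = (\<Union>i<n. A i)"
      have fam: "disjoint_family_on A {..<n}"
        using union by (auto simp: disjoint_family_on_def)
      have [measurable]: "U \<in> sets S" by (simp add: U_def)
      have pU: "P.prob U = (\<Sum>i<n. P.prob (A i))"
        unfolding U_def using fam by (intro P.finite_measure_finite_Union) auto
      have "\<forall>i. \<exists>m. \<forall>k\<ge>m. \<forall>B\<in>sets S. \<bar>d (A i) k B\<bar> \<le> \<epsilon> / (2 * (n + 1))"
        using union.IH \<open>0 < \<epsilon>\<close> by (auto simp del: of_nat_add)
      then obtain m where m: "\<And>i k B. k \<ge> m i \<Longrightarrow> B \<in> sets S \<Longrightarrow> \<bar>d (A i) k B\<bar> \<le> \<epsilon> / (2 * (n + 1))"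
        by metis
      have "\<bar>d (\<Union>i. A i) k B\<bar> \<le> \<epsilon>" if k: "\<forall>i<n. m i \<le> k" and B[measurable]: "B \<in> sets S" for k B
      proof -
        define V where "V = (\<Union>i. A i) - U"
        have [measurable]: "V \<in> sets S" by (simp add: V_def)
        have "U \<subseteq> (\<Union>i. A i)" by (auto simp: U_def)
        then have pV: "P.prob V = P.prob (\<Union>i. A i) - P.prob U"
          unfolding V_def by (intro P.finite_measure_Diff) auto
        have "U \<inter> C k B = (\<Union>i<n. A i \<inter> C k B)" by (auto simp: U_def)
        also have "P.prob \<dots> = (\<Sum>i<n. P.prob (A i \<inter> C k B))"
          using union by (intro P.finite_measure_finite_Union) (auto simp: disjoint_family_on_def)
        finally have dU: "d U k B = (\<Sum>i<n. d (A i) k B)"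
          by (simp add: d_def pU sum_subtractf sum_distrib_right)
        have "P.prob ((\<Union>i. A i) \<inter> C k B) = P.prob (U \<inter> C k B \<union> V \<inter> C k B)"
          using \<open>U \<subseteq> (\<Union>i. A i)\<close> by (intro arg_cong[where f = P.prob]) (auto simp: V_def)
        also have "\<dots> = P.prob (U \<inter> C k B) + P.prob (V \<inter> C k B)"
          by (rule P.finite_measure_Union) (auto simp: V_def)
        finally have split: "d (\<Union>i. A i) k B = d U k B + d V k B"
          using pV by (simp add: d_def left_diff_distrib)
        have "\<bar>d V k B\<bar> \<le> P.prob V"
        proof -
          have "P.prob (V \<inter> C k B) \<le> P.prob V" by (rule P.finite_measure_mono) auto
          moreover have "P.prob V * P.prob B \<le> P.prob V" by (simp add: mult_left_le)
          ultimately show ?thesis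
            unfolding d_def by (smt (verit) measure_nonneg mult_nonneg_nonneg)
        qed
        moreover have "\<bar>d U k B\<bar> \<le> (\<Sum>i<n. \<epsilon> / (2 * (n + 1)))"
          unfolding dU using k by (intro order_trans[OF sum_abs] sum_mono m B) auto
        moreover have "(\<Sum>i<n. \<epsilon> / (2 * (n + 1))) \<le> \<epsilon> / 2"
          using \<open>0 < \<epsilon>\<close> by (simp add: field_simps)
        ultimately show ?thesis using n pV pU split by linarith
      qed
      \<comment> \<open>The sum of the finitely many thresholds \<open>m i\<close> is a common
        threshold.\<close>
      then show "\<exists>m. \<forall>k\<ge>m. \<forall>B\<in>sets S. \<bar>d (\<Union>i. A i) k B\<bar> \<le> \<epsilon>"
        using member_le_sum[of _ "{..<n}" m] by (meson finite_lessThan lessThan_iff order_trans zero_le)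
    qed
  qed
  then show ?thesis using \<open>0 < \<epsilon>\<close> by (simp add: d_def C_def)
qed

end

section \<open>The law of the past of i.i.d. innovations\<close>

locale iid_past = prob_space +
  fixes e :: "int \<Rightarrow> 'a \<Rightarrow> real"
  assumes indep: "indep_vars (\<lambda>_. borel) e UNIV"
    and ident: "\<And>t. distr M borel (e t) = distr M borel (e 1)"
begin

definition past_law :: "(nat \<Rightarrow> real) measure" where
  "past_law = (\<Pi>\<^sub>M i\<in>UNIV. distr M borel (e 1))"

lemma measurable_e [measurable]: "e t \<in> borel_measurable M"
  using indep by (auto simp: indep_vars_def)

lemma sets_past_law [measurable_cong, simp]: "sets past_law = sets past_space"
  unfolding past_law_def by (intro sets_PiM_cong) auto

lemma space_past_law [simp]: "space past_law = UNIV"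
  by (simp add: past_law_def space_PiM)

lemma measurable_past [measurable]: "past e t \<in> M \<rightarrow>\<^sub>M past_space"
proof -
  have "past e t = (\<lambda>\<omega> j. e (t - int j) \<omega>)" by (simp add: past_def fun_eq_iff)
  then show ?thesis by (auto intro!: measurable_PiM_single' simp: space_PiM PiE_iff)
qed

text \<open>The past at \<open>t\<close> reindexes the whole innovation sequence by the injective
  map \<open>j \<mapsto> t - j\<close>. Since all marginals coincide, the product law obtained is
  the same for every \<open>t\<close>.\<close>

lemma distr_past: "distr M past_space (past e t) = past_law"
proof -
  define P where "P = (\<lambda>i::int. distr M borel (e i))"
  have pr: "prob_space (P i)" for i unfolding P_def by (intro prob_space_distr) measurable
  have sP: "sets (\<Pi>\<^sub>M i\<in>UNIV. P i) = sets path_space"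
    by (intro sets_PiM_cong) (auto simp: P_def)
  have sP': "sets (\<Pi>\<^sub>M i\<in>UNIV. P (f i)) = sets past_space" for f :: "nat \<Rightarrow> int"
    by (intro sets_PiM_cong) (auto simp: P_def)
  have me: "(\<lambda>\<omega> i. e i \<omega>) \<in> M \<rightarrow>\<^sub>M path_space"
    by (auto intro!: measurable_PiM_single' simp: space_PiM PiE_iff)
  have joint: "distr M path_space (\<lambda>\<omega> i. e i \<omega>) = (\<Pi>\<^sub>M i\<in>UNIV. P i)"
    using indep_vars_iff_distr_eq_PiM[where I = UNIV and M' = "\<lambda>_. borel" and X = e] indep by (simp add: P_def restrict_def)
  have tail: "(\<lambda>x n. x (t - int n)) \<in> path_space \<rightarrow>\<^sub>M past_space"
    by (auto intro!: measurable_PiM_single' simp: space_PiM PiE_iff)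
  have "distr (\<Pi>\<^sub>M i\<in>UNIV. P i) (\<Pi>\<^sub>M n\<in>UNIV. P (t - int n)) (\<lambda>x. \<lambda>n\<in>UNIV. x (t - int n))
      = (\<Pi>\<^sub>M n\<in>UNIV. P (t - int n))"
    using pr by (intro distr_PiM_reindex) (auto intro: injI)
  moreover have "P = (\<lambda>_. distr M borel (e 1))"
    unfolding P_def by (intro ext ident)
  ultimately have tail_eq: "distr (\<Pi>\<^sub>M i\<in>UNIV. P i) past_law (\<lambda>x n. x (t - int n)) = past_law"
    by (simp add: past_law_def restrict_def)
  have "distr M past_space (past e t) = distr (distr M path_space (\<lambda>\<omega> i. e i \<omega>)) past_space (\<lambda>x n. x (t - int n))"
    by (simp add: distr_distr[OF tail me] comp_def past_def[abs_def])
  also have "\<dots> = distr (\<Pi>\<^sub>M i\<in>UNIV. P i) past_law (\<lambda>x n. x (t - int n))"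
    unfolding joint by (rule distr_cong) simp_all
  also have "\<dots> = past_law" by (rule tail_eq)
  finally show ?thesis .
qed

text \<open>The product measure of this instance is \<open>past_law\<close>, so
  \<open>mixing\<close> becomes available for it.\<close>

sublocale past: sequence_space "distr M borel (e 1)"
  unfolding sequence_space_def by (intro product_prob_spaceI prob_space_distr) measurable

lemma prob_space_past_law: "prob_space past_law"
  unfolding past_law_def by (rule past.P.prob_space_axioms)

lemma shift_past: "shift k (past e t \<omega>) = past e (t - int k) \<omega>"
  by (simp add: shift_def past_def fun_eq_iff algebra_simps)

text \<open>Norms of functions of the past are moved to one fixed law and thus do not depend on
  \<open>t\<close>.\<close>

lemma Lq_norm_past:
  assumes "h \<in> borel_measurable past_space"
  shows "Lq_norm M q (\<lambda>\<omega>. h (past e t \<omega>)) = Lq_norm past_law q h"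
  using Lq_norm_distr[OF measurable_past assms] by (simp add: distr_past)

lemma prob_past:
  assumes "A \<in> sets past_space"
  shows "prob (past e t -` A \<inter> space M) = measure past_law A"
  using measure_distr[OF measurable_past assms] by (simp add: distr_past)

section \<open>Law of large numbers for weighted averages\<close>

text \<open>The weights are arbitrary apart from their total mass \<open>S\<close> and largest size
  \<open>\<eta>\<close>. For large \<open>n b\<close> the kernel weights at every \<open>u\<close>
  are of this kind, so a single \<open>\<eta>\<close> serves all \<open>u\<close>.\<close>

definition averages_le :: "real \<Rightarrow> ((nat \<Rightarrow> real) \<Rightarrow> real) \<Rightarrow> real \<Rightarrow> real \<Rightarrow> real \<Rightarrow> bool" where
  "averages_le q h S \<eta> \<epsilon> \<longleftrightarrow> (\<forall>T w. finite T \<longrightarrow> (\<Sum>t\<in>T. \<bar>w t\<bar>) \<le> S \<longrightarrow> (\<forall>t\<in>T. \<bar>w t\<bar> \<le> \<eta>) \<longrightarrow>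
     Lq_norm M q (\<lambda>\<omega>. \<Sum>t\<in>T. w t * h (past e t \<omega>)) \<le> ennreal \<epsilon>)"

lemma averages_leI:
  assumes "\<And>T w. finite T \<Longrightarrow> (\<Sum>t\<in>T. \<bar>w t\<bar>) \<le> S \<Longrightarrow> (\<forall>t\<in>T. \<bar>w t\<bar> \<le> \<eta>) \<Longrightarrow>
     Lq_norm M q (\<lambda>\<omega>. \<Sum>t\<in>T. w t * h (past e t \<omega>)) \<le> ennreal \<epsilon>"
  shows "averages_le q h S \<eta> \<epsilon>"
  unfolding averages_le_def by (intro allI impI assms)

lemma averages_leD:
  assumes "averages_le q h S \<eta> \<epsilon>" "finite T" "(\<Sum>t\<in>T. \<bar>w t\<bar>) \<le> S" "\<forall>t\<in>T. \<bar>w t\<bar> \<le> \<eta>"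
  shows "Lq_norm M q (\<lambda>\<omega>. \<Sum>t\<in>T. w t * h (past e t \<omega>)) \<le> ennreal \<epsilon>"
  using assms(1)[unfolded averages_le_def, rule_format, of T w] assms(2-) by simp

definition averages_vanish :: "real \<Rightarrow> ((nat \<Rightarrow> real) \<Rightarrow> real) \<Rightarrow> bool" where
  "averages_vanish q h \<longleftrightarrow> (\<forall>S>0. \<forall>\<epsilon>>0. \<exists>\<eta>>0. averages_le q h S \<eta> \<epsilon>)"

lemma averages_vanishI:
  assumes "\<And>S \<epsilon>. 0 < S \<Longrightarrow> 0 < \<epsilon> \<Longrightarrow> \<exists>\<eta>>0. averages_le q h S \<eta> \<epsilon>"
  shows "averages_vanish q h"
  using assms unfolding averages_vanish_def by blast

lemma averages_vanishD:
  assumes "averages_vanish q h" "0 < S" "0 < \<epsilon>"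
  obtains \<eta> where "0 < \<eta>" "averages_le q h S \<eta> \<epsilon>"
  using assms unfolding averages_vanish_def by blast

lemma averages_vanish_zero: "averages_vanish q (\<lambda>_. 0)"
proof (rule averages_vanishI)
  show "\<exists>\<eta>>0. averages_le q (\<lambda>_. 0) S \<eta> \<epsilon>" for S \<epsilon>
    by (intro exI[of _ 1] conjI averages_leI) (simp_all add: Lq_norm_zero)
qed

lemma averages_vanish_add:
  assumes q: "1 \<le> q" and [measurable]: "g \<in> borel_measurable past_space" "h \<in> borel_measurable past_space"
    and g: "averages_vanish q g" and h: "averages_vanish q h"
  shows "averages_vanish q (\<lambda>x. g x + h x)"
proof (rule averages_vanishI)
  fix S \<epsilon> :: real assume pos: "0 < S" "0 < \<epsilon>"
  obtain \<eta>1 where \<eta>1: "0 < \<eta>1" "averages_le q g S \<eta>1 (\<epsilon> / 2)"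
    using averages_vanishD[OF g \<open>0 < S\<close> half_gt_zero[OF \<open>0 < \<epsilon>\<close>]] .
  obtain \<eta>2 where \<eta>2: "0 < \<eta>2" "averages_le q h S \<eta>2 (\<epsilon> / 2)"
    using averages_vanishD[OF h \<open>0 < S\<close> half_gt_zero[OF \<open>0 < \<epsilon>\<close>]] .
  have "Lq_norm M q (\<lambda>\<omega>. \<Sum>t\<in>T. w t * (g (past e t \<omega>) + h (past e t \<omega>))) \<le> ennreal \<epsilon>"
    if "finite T" "(\<Sum>t\<in>T. \<bar>w t\<bar>) \<le> S" "\<forall>t\<in>T. \<bar>w t\<bar> \<le> min \<eta>1 \<eta>2" for T w
  proof -
    have "Lq_norm M q (\<lambda>\<omega>. (\<Sum>t\<in>T. w t * g (past e t \<omega>)) + (\<Sum>t\<in>T. w t * h (past e t \<omega>)))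
        \<le> ennreal (\<epsilon> / 2 + \<epsilon> / 2)"
      using that pos averages_leD[OF \<eta>1(2), of T w] averages_leD[OF \<eta>2(2), of T w] by (intro Lq_norm_add q) auto
    then show ?thesis by (simp add: distrib_left sum.distrib)
  qed
  then have "averages_le q (\<lambda>x. g x + h x) S (min \<eta>1 \<eta>2) \<epsilon>" by (rule averages_leI)
  then show "\<exists>\<eta>>0. averages_le q (\<lambda>x. g x + h x) S \<eta> \<epsilon>"
    using \<eta>1(1) \<eta>2(1) by (intro exI[of _ "min \<eta>1 \<eta>2"]) auto
qed

lemma averages_vanish_cmult:
  assumes q: "1 \<le> q" and [measurable]: "h \<in> borel_measurable past_space"
    and h: "averages_vanish q h"
  shows "averages_vanish q (\<lambda>x. c * h x)"
proof (rule averages_vanishI)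
  fix S \<epsilon> :: real assume pos: "0 < S" "0 < \<epsilon>"
  \<comment> \<open>The factor is absorbed into the weights; \<open>\<bar>c\<bar> + 1\<close> in
    place of \<open>\<bar>c\<bar>\<close> covers \<open>c = 0\<close>.\<close>
  have "0 < (\<bar>c\<bar> + 1) * S" using pos by (intro mult_pos_pos) auto
  from averages_vanishD[OF h this \<open>0 < \<epsilon>\<close>]
  obtain \<eta> where \<eta>: "0 < \<eta>" "averages_le q h ((\<bar>c\<bar> + 1) * S) \<eta> \<epsilon>" .
  have "Lq_norm M q (\<lambda>\<omega>. \<Sum>t\<in>T. w t * (c * h (past e t \<omega>))) \<le> ennreal \<epsilon>"
    if T: "finite T" "(\<Sum>t\<in>T. \<bar>w t\<bar>) \<le> S" "\<forall>t\<in>T. \<bar>w t\<bar> \<le> \<eta> / (\<bar>c\<bar> + 1)" for T w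
  proof -
    have "(\<Sum>t\<in>T. \<bar>c * w t\<bar>) \<le> (\<bar>c\<bar> + 1) * S"
    proof -
      have "\<bar>c\<bar> * (\<Sum>t\<in>T. \<bar>w t\<bar>) \<le> (\<bar>c\<bar> + 1) * S"
        using T(2) pos by (intro mult_mono) auto
      then show ?thesis by (simp add: abs_mult sum_distrib_left)
    qed
    moreover have "\<bar>c * w t\<bar> \<le> \<eta>" if "t \<in> T" for t
    proof -
      have "\<bar>c\<bar> * \<bar>w t\<bar> \<le> (\<bar>c\<bar> + 1) * (\<eta> / (\<bar>c\<bar> + 1))"
        using T(3) that by (intro mult_mono) auto
      then show ?thesis by (simp add: abs_mult)
    qed
    ultimately show ?thesis
      using averages_leD[OF \<eta>(2), of T "\<lambda>t. c * w t"] T(1) by (simp add: mult_ac)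
  qed
  then have "averages_le q (\<lambda>x. c * h x) S (\<eta> / (\<bar>c\<bar> + 1)) \<epsilon>" by (rule averages_leI)
  then show "\<exists>\<eta>>0. averages_le q (\<lambda>x. c * h x) S \<eta> \<epsilon>"
    using \<eta>(1) by (intro exI[of _ "\<eta> / (\<bar>c\<bar> + 1)"]) auto
qed

lemma averages_vanish_sum:
  assumes q: "1 \<le> q" and "finite I" and m: "\<And>i. i \<in> I \<Longrightarrow> h i \<in> borel_measurable past_space"
    and "\<And>i. i \<in> I \<Longrightarrow> averages_vanish q (h i)"
  shows "averages_vanish q (\<lambda>x. \<Sum>i\<in>I. h i x)"
  using assms(2-)
proof (induction I)
  case empty
  then show ?case by (simp add: averages_vanish_zero)
next
  case (insert i I)
  then show ?case by (simp add: averages_vanish_add[OF q])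
qed

text \<open>Replacing \<open>h\<close> by \<open>g\<close> costs at most the total mass
  \<open>S\<close> times the norm of \<open>h - g\<close>, whatever the weights; this fixes the
  choice \<open>\<delta> = \<epsilon> / (2 * S)\<close>.\<close>

lemma averages_vanish_limit:
  assumes q: "1 \<le> q" and [measurable]: "h \<in> borel_measurable past_space"
    and approx: "\<And>\<delta>. 0 < \<delta> \<Longrightarrow> \<exists>g \<in> borel_measurable past_space.
        averages_vanish q g \<and> Lq_norm past_law q (\<lambda>x. h x - g x) \<le> ennreal \<delta>"
  shows "averages_vanish q h"
proof (rule averages_vanishI)
  fix S \<epsilon> :: real assume pos: "0 < S" "0 < \<epsilon>"
  define \<delta> where "\<delta> = \<epsilon> / (2 * S)"
  have "0 < \<delta>" using pos by (simp add: \<delta>_def)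
  from approx[OF this] obtain g where [measurable]: "g \<in> borel_measurable past_space"
    and g: "averages_vanish q g" and d: "Lq_norm past_law q (\<lambda>x. h x - g x) \<le> ennreal \<delta>" by blast
  obtain \<eta> where \<eta>: "0 < \<eta>" "averages_le q g S \<eta> (\<epsilon> / 2)"
    using averages_vanishD[OF g \<open>0 < S\<close> half_gt_zero[OF \<open>0 < \<epsilon>\<close>]] .
  have "Lq_norm M q (\<lambda>\<omega>. \<Sum>t\<in>T. w t * h (past e t \<omega>)) \<le> ennreal \<epsilon>"
    if T: "finite T" "(\<Sum>t\<in>T. \<bar>w t\<bar>) \<le> S" "\<forall>t\<in>T. \<bar>w t\<bar> \<le> \<eta>" for T w
  proof -
    have "Lq_norm M q (\<lambda>\<omega>. h (past e t \<omega>) - g (past e t \<omega>)) \<le> ennreal \<delta>" for t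
      using Lq_norm_past[of "\<lambda>x. h x - g x" q t] d by simp
    then have "Lq_norm M q (\<lambda>\<omega>. \<Sum>t\<in>T. w t * (h (past e t \<omega>) - g (past e t \<omega>))) \<le> ennreal (S * \<delta>)"
      using T \<open>0 < \<delta>\<close> by (intro Lq_norm_weighted_sum q) auto
    then have "Lq_norm M q (\<lambda>\<omega>. (\<Sum>t\<in>T. w t * g (past e t \<omega>))
        + (\<Sum>t\<in>T. w t * (h (past e t \<omega>) - g (past e t \<omega>)))) \<le> ennreal (\<epsilon> / 2 + S * \<delta>)"
      using T pos \<open>0 < \<delta>\<close> averages_leD[OF \<eta>(2), of T w] by (intro Lq_norm_add q) auto
    moreover have "\<epsilon> / 2 + S * \<delta> = \<epsilon>" using pos by (simp add: \<delta>_def)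
    ultimately show ?thesis by (simp add: sum.distrib[symmetric] distrib_left[symmetric])
  qed
  then have "averages_le q h S \<eta> \<epsilon>" by (rule averages_leI)
  then show "\<exists>\<eta>>0. averages_le q h S \<eta> \<epsilon>"
    using \<eta>(1) by blast
qed

text \<open>The sum is bounded by \<open>S\<close>, so its \<open>q\<close>-th moment is controlled by its second moment, a double
  sum of covariances that are small off a band around the diagonal.\<close>

lemma averages_vanish_indicator:
  assumes q: "2 \<le> q" and A[measurable]: "A \<in> sets past_space"
  shows "averages_vanish q (\<lambda>x. indicator A x - measure past_law A)"
proof (rule averages_vanishI)
  fix S \<epsilon> :: real assume pos: "0 < S" "0 < \<epsilon>"
  define p where "p = measure past_law A"
  define Z where "Z t \<omega> = indicator A (past e t \<omega>) - p" for t \<omega>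
  have "0 \<le> p" "p \<le> 1"
    using prob_space.prob_le_1[OF prob_space_past_law] by (auto simp: p_def)
  then have Z1: "\<bar>Z t \<omega>\<bar> \<le> 1" for t \<omega> by (auto simp: Z_def indicator_def)
  have [measurable]: "Z t \<in> borel_measurable M" for t
  proof -
    have "Z t = (\<lambda>\<omega>. indicator A (past e t \<omega>) - p)" by (simp add: Z_def fun_eq_iff)
    then show ?thesis by simp
  qed
  \<comment> \<open>\<open>\<delta>\<close> bounds covariances far from the diagonal, and
    \<open>\<eta>\<close> below pays for the band near it. Both are solved from the final moment
    bound \<open>S powr (q - 2) * (S * (2 * (m + 1) * \<eta> + \<delta> * S))\<close>, where each
    contributes half of \<open>\<epsilon> powr q\<close>.\<close>
  define \<delta> where "\<delta> = \<epsilon> powr q / (2 * S powr q)"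
  have "0 < \<delta>" using pos by (simp add: \<delta>_def)
  obtain m where m: "\<And>k B. k \<ge> m \<Longrightarrow> B \<in> sets past_space \<Longrightarrow>
      \<bar>measure past_law (A \<inter> (shift k -` B)) - p * measure past_law B\<bar> \<le> \<delta>"
    using past.mixing[of A \<delta>] \<open>0 < \<delta>\<close> A unfolding past_law_def[symmetric] p_def by auto
  define \<eta> where "\<eta> = \<epsilon> powr q / (4 * (m + 1) * S powr (q - 1))"
  have "0 < \<eta>" using pos by (auto simp: \<eta>_def)
  have Zint: "integrable M (\<lambda>\<omega>. Z t \<omega> * Z s \<omega>)" for t s
    using Z1 mult_mono[OF Z1 Z1]
    by (intro integrable_const_bound[where B = 1]) (auto simp: abs_mult)
  define \<gamma> where "\<gamma> t s = expectation (\<lambda>\<omega>. Z t \<omega> * Z s \<omega>)" for t s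
  have \<gamma>1: "\<bar>\<gamma> t s\<bar> \<le> 1" for t s
  proof -
    have "\<bar>\<gamma> t s\<bar> \<le> expectation (\<lambda>\<omega>. \<bar>Z t \<omega> * Z s \<omega>\<bar>)"
      unfolding \<gamma>_def by (rule integral_abs_bound)
    also have "\<dots> \<le> expectation (\<lambda>_. 1)"
      using integrable_abs[OF Zint[of t s]] mult_mono[OF Z1 Z1] by (intro integral_mono) (auto simp: abs_mult)
    finally show ?thesis by (simp add: prob_space)
  qed
  \<comment> \<open>The past at the earlier time \<open>s\<close> is the \<open>k\<close>-fold shift
    of the past at \<open>t\<close>, so \<open>\<gamma> t s\<close> compares the probability of
    \<open>A\<close> meeting its shifted copy with \<open>p * p\<close>.\<close>
  have far: "\<bar>\<gamma> t s\<bar> \<le> \<delta>" if "s + int m \<le> t" for t s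
  proof -
    define k where "k = nat (t - s)"
    have k: "k \<ge> m" "s = t - int k" using that by (auto simp: k_def)
    have "Z t \<omega> * Z s \<omega> = indicator (past e t -` (A \<inter> (shift k -` A)) \<inter> space M) \<omega>
        - p * indicator (past e t -` A \<inter> space M) \<omega> - p * indicator (past e s -` A \<inter> space M) \<omega> + p * p"
      if "\<omega> \<in> space M" for \<omega>
      using that by (auto simp: Z_def k(2) shift_past indicator_def algebra_simps)
    then have "\<gamma> t s = expectation (\<lambda>\<omega>. indicator (past e t -` (A \<inter> (shift k -` A)) \<inter> space M) \<omega>
        - p * indicator (past e t -` A \<inter> space M) \<omega> - p * indicator (past e s -` A \<inter> space M) \<omega> + p * p)"
      unfolding \<gamma>_def by (intro Bochner_Integration.integral_cong) auto
    also have "\<dots> = prob (past e t -` (A \<inter> (shift k -` A)) \<inter> space M) - p * p - p * p + p * p"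
    proof -
      have sA: "A \<inter> (shift k -` A) \<in> sets past_space"
        using measurable_sets[OF measurable_shift A, of k] A by (auto simp: space_PiM)
      have "past e t -` (A \<inter> (shift k -` A)) \<inter> space M \<in> events" for t
        using sA by (rule measurable_sets[OF measurable_past])
      moreover have "past e t -` A \<inter> space M \<in> events" for t by measurable
      moreover have "prob (past e t -` A \<inter> space M) = p" for t
        using prob_past[OF A] by (simp add: p_def)
      moreover have "expectation (\<lambda>\<omega>. indicator U \<omega> - p * indicator V \<omega> - p * indicator W \<omega> + p * p)
          = prob U - p * prob V - p * prob W + p * p" if "U \<in> events" "V \<in> events" "W \<in> events" for U V W
        using that by (simp add: prob_space Int_absorb2 sets.sets_into_space emeasure_eq_measure)
      ultimately show ?thesis by presburger
    qed
    also have "prob (past e t -` (A \<inter> (shift k -` A)) \<inter> space M) = measure past_law (A \<inter> (shift k -` A))"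
      using measurable_sets[OF measurable_shift A, of k] A
      by (intro prob_past) (auto simp: space_PiM)
    finally show ?thesis using m[OF k(1) A] by (simp add: p_def)
  qed
  have \<gamma>\<delta>: "\<bar>\<gamma> t s\<bar> \<le> \<delta>" if "int m \<le> \<bar>t - s\<bar>" for t s
    using far[of s t] far[of t s] that by (cases "s \<le> t") (auto simp: \<gamma>_def mult.commute)
  have "Lq_norm M q (\<lambda>\<omega>. \<Sum>t\<in>T. w t * Z t \<omega>) \<le> ennreal \<epsilon>"
    if T: "finite T" "(\<Sum>t\<in>T. \<bar>w t\<bar>) \<le> S" "\<forall>t\<in>T. \<bar>w t\<bar> \<le> \<eta>" for T w
  proof -
    define Y where "Y \<omega> = (\<Sum>t\<in>T. w t * Z t \<omega>)" for \<omega>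
    have [measurable]: "Y \<in> borel_measurable M"
      unfolding Y_def[abs_def] by measurable
    have YS: "\<bar>Y \<omega>\<bar> \<le> S" for \<omega>
    proof -
      have "\<bar>Y \<omega>\<bar> \<le> (\<Sum>t\<in>T. \<bar>w t * Z t \<omega>\<bar>)" unfolding Y_def by (rule sum_abs)
      also have "\<dots> \<le> (\<Sum>t\<in>T. \<bar>w t\<bar>)"
        using Z1 by (intro sum_mono) (simp add: abs_mult mult_left_le)
      finally show ?thesis using T by simp
    qed
    have Y2: "expectation (\<lambda>\<omega>. (Y \<omega>)\<^sup>2) \<le> S * (2 * (m + 1) * \<eta> + \<delta> * S)"
    proof -
      have "expectation (\<lambda>\<omega>. (Y \<omega>)\<^sup>2) = expectation (\<lambda>\<omega>. \<Sum>t\<in>T. \<Sum>s\<in>T. w t * w s * (Z t \<omega> * Z s \<omega>))"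
        by (simp add: Y_def power2_eq_square sum_product mult_ac)
      also have "\<dots> = (\<Sum>t\<in>T. \<Sum>s\<in>T. w t * w s * \<gamma> t s)"
        using Zint by (simp add: \<gamma>_def Bochner_Integration.integral_sum)
      also have "\<dots> \<le> (\<Sum>t\<in>T. \<bar>w t\<bar> * (2 * (m + 1) * \<eta> + \<delta> * S))"
      proof (rule sum_mono)
        fix t assume "t \<in> T"
        have "(\<Sum>s\<in>T. w t * w s * \<gamma> t s) \<le> (\<Sum>s\<in>T. \<bar>w t\<bar> * (\<bar>w s\<bar> * \<bar>\<gamma> t s\<bar>))"
          by (intro sum_mono) (metis abs_ge_self abs_mult mult.assoc)
        also have "\<dots> = \<bar>w t\<bar> * (\<Sum>s\<in>T. \<bar>w s\<bar> * \<bar>\<gamma> t s\<bar>)" by (simp add: sum_distrib_left)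
        \<comment> \<open>At most \<open>2 * m + 1\<close> indices lie within distance
          \<open>m\<close> of \<open>t\<close>; there the covariance is bounded by 1 and the weight
          by \<open>\<eta>\<close>. Elsewhere the covariance is at most
          \<open>\<delta>\<close>.\<close>
        also have "(\<Sum>s\<in>T. \<bar>w s\<bar> * \<bar>\<gamma> t s\<bar>)
            \<le> (\<Sum>s\<in>T. (if s \<in> {t - int m..t + int m} then \<eta> else 0) + \<delta> * \<bar>w s\<bar>)"
        proof (rule sum_mono)
          fix s assume "s \<in> T"
          show "\<bar>w s\<bar> * \<bar>\<gamma> t s\<bar> \<le> (if s \<in> {t - int m..t + int m} then \<eta> else 0) + \<delta> * \<bar>w s\<bar>"
          proof (cases "s \<in> {t - int m..t + int m}")
            case True
            have "\<bar>w s\<bar> * \<bar>\<gamma> t s\<bar> \<le> \<eta> * 1"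
              using T \<open>s \<in> T\<close> \<open>0 < \<eta>\<close> \<gamma>1 by (intro mult_mono) auto
            moreover have "0 \<le> \<delta> * \<bar>w s\<bar>" using \<open>0 < \<delta>\<close> by simp
            ultimately show ?thesis using True by simp
          next
            case False
            then have "\<bar>w s\<bar> * \<bar>\<gamma> t s\<bar> \<le> \<bar>w s\<bar> * \<delta>"
              by (intro mult_left_mono \<gamma>\<delta>) auto
            then show ?thesis unfolding if_not_P[OF False] by (simp add: mult.commute)
          qed
        qed
        also have "\<dots> = card (T \<inter> {t - int m..t + int m}) * \<eta> + \<delta> * (\<Sum>s\<in>T. \<bar>w s\<bar>)"
          using T(1) by (simp add: sum.distrib sum_distrib_left sum.If_cases Int_def)
        also have "\<dots> \<le> 2 * (m + 1) * \<eta> + \<delta> * S"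
        proof -
          have "card (T \<inter> {t - int m..t + int m}) \<le> card {t - int m..t + int m}"
            by (intro card_mono) auto
          then have "card (T \<inter> {t - int m..t + int m}) \<le> 2 * (m + 1)" by simp
          then have "real (card (T \<inter> {t - int m..t + int m})) \<le> real (2 * (m + 1))"
            by (simp only: of_nat_le_iff)
          then show ?thesis
            using T(2) \<open>0 < \<eta>\<close> \<open>0 < \<delta>\<close> by (intro add_mono mult_mono) auto
        qed
        finally show "(\<Sum>s\<in>T. w t * w s * \<gamma> t s) \<le> \<bar>w t\<bar> * (2 * (m + 1) * \<eta> + \<delta> * S)"
          by (simp add: mult_left_mono)
      qed
      also have "\<dots> = (\<Sum>t\<in>T. \<bar>w t\<bar>) * (2 * (m + 1) * \<eta> + \<delta> * S)" by (simp add: sum_distrib_right)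
      also have "\<dots> \<le> S * (2 * (m + 1) * \<eta> + \<delta> * S)"
        using T \<open>0 < \<eta>\<close> \<open>0 < \<delta>\<close> pos by (intro mult_right_mono) auto
      finally show ?thesis .
    qed
    have "(Y \<omega>)\<^sup>2 \<le> S\<^sup>2" for \<omega>
      using YS[of \<omega>] by (metis abs_ge_zero power2_abs power_mono)
    then have Y2int: "integrable M (\<lambda>\<omega>. (Y \<omega>)\<^sup>2)"
      by (intro integrable_const_bound[where B = "S\<^sup>2"]) auto
    have pw: "\<bar>Y \<omega>\<bar> powr q \<le> S powr (q - 2) * (Y \<omega>)\<^sup>2" for \<omega>
    proof (cases "Y \<omega> = 0")
      case False
      have "\<bar>Y \<omega>\<bar> powr q = \<bar>Y \<omega>\<bar> powr (q - 2) * \<bar>Y \<omega>\<bar> powr 2"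
        using powr_add[of "\<bar>Y \<omega>\<bar>" "q - 2" 2] by simp
      also have "\<dots> \<le> S powr (q - 2) * \<bar>Y \<omega>\<bar> powr 2"
        using q YS by (intro mult_right_mono powr_mono2) auto
      finally show ?thesis using False by (simp add: powr_numeral)
    qed simp
    have "(\<integral>\<^sup>+\<omega>. ennreal (\<bar>Y \<omega>\<bar> powr q) \<partial>M) \<le> (\<integral>\<^sup>+\<omega>. ennreal (S powr (q - 2) * (Y \<omega>)\<^sup>2) \<partial>M)"
      using pw by (intro nn_integral_mono ennreal_leI)
    also have "\<dots> = ennreal (expectation (\<lambda>\<omega>. S powr (q - 2) * (Y \<omega>)\<^sup>2))"
      using Y2int by (intro nn_integral_eq_integral) auto
    also have "\<dots> = ennreal (S powr (q - 2) * expectation (\<lambda>\<omega>. (Y \<omega>)\<^sup>2))" by simp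
    also have "\<dots> \<le> ennreal (S powr (q - 2) * (S * (2 * (m + 1) * \<eta> + \<delta> * S)))"
      by (intro ennreal_leI mult_left_mono Y2) auto
    also have "S powr (q - 2) * (S * (2 * (m + 1) * \<eta> + \<delta> * S)) = \<epsilon> powr q"
    proof -
      have s1: "S powr (q - 2) * S = S powr (q - 1)" and s2: "S powr (q - 1) * S = S powr q"
        using pos powr_mult_base[of S "q - 2"] powr_mult_base[of S "q - 1"] by (simp_all add: mult.commute)
      have "S powr (q - 2) * (S * (2 * (m + 1) * \<eta> + \<delta> * S))
          = 2 * (m + 1) * \<eta> * S powr (q - 1) + \<delta> * S powr q"
        unfolding s2[symmetric] s1[symmetric] by (simp add: algebra_simps)
      also have "\<dots> = \<eta> * (4 * (m + 1) * S powr (q - 1)) / 2 + \<delta> * (2 * S powr q) / 2" by simp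
      also have "\<eta> * (4 * (m + 1) * S powr (q - 1)) = \<epsilon> powr q"
        unfolding \<eta>_def using pos by (intro nonzero_eq_divide_eq[THEN iffD1, OF _ refl]) auto
      also have "\<delta> * (2 * S powr q) = \<epsilon> powr q" using pos by (simp add: \<delta>_def)
      finally show ?thesis by simp
    qed
    finally show ?thesis
      using q pos by (simp add: Lq_norm_le_iff Y_def)
  qed
  then have "averages_le q (\<lambda>x. indicator A x - measure past_law A) S \<eta> \<epsilon>"
    unfolding Z_def p_def by (rule averages_leI)
  then show "\<exists>\<eta>>0. averages_le q (\<lambda>x. indicator A x - measure past_law A) S \<eta> \<epsilon>"
    using \<open>0 < \<eta>\<close> by blast
qed

text \<open>Simple functions dominated by a multiple of \<open>h\<close> converge to
  \<open>h\<close> in \<open>L\<^sup>q\<close>, and a simple function minus its mean is a linear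
  combination of centered indicators.\<close>

lemma averages_vanish_centered:
  assumes q: "2 \<le> q" and h[measurable]: "h \<in> borel_measurable past_space"
    and fin: "Lq_norm past_law q h < \<infinity>"
  shows "averages_vanish q (\<lambda>x. h x - (LINT y|past_law. h y))"
proof (rule averages_vanish_limit)
  interpret L: prob_space past_law by (rule prob_space_past_law)
  have q1: "1 \<le> q" using q by simp
  have hL: "h \<in> borel_measurable past_law" by measurable
  fix \<delta> :: real assume "0 < \<delta>"
  obtain F where F: "\<And>i. simple_function past_law (F i)"
      "\<And>x. (\<lambda>i. F i x) \<longlonglongrightarrow> h x" "\<And>i x. dist (F i x) 0 \<le> 2 * dist (h x) 0"
    using borel_measurable_implies_sequence_metric[OF hL, of 0] by auto
  have FL[measurable]: "F i \<in> borel_measurable past_law" for i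
    using F(1) by (rule borel_measurable_simple_function)
  obtain a where a: "Lq_norm past_law q h \<le> ennreal a" "0 \<le> a"
    using fin by (cases "Lq_norm past_law q h") auto
  have "\<exists>N. \<forall>i\<ge>N. Lq_norm past_law q (\<lambda>x. h x - F i x) \<le> ennreal (\<delta> / 3)"
  proof (rule Lq_norm_dominated)
    show "AE x in past_law. (\<lambda>i. h x - F i x) \<longlonglongrightarrow> 0"
      using F(2) by (auto intro!: AE_I2 tendsto_eq_intros)
    show "AE x in past_law. \<bar>h x - F i x\<bar> \<le> 3 * \<bar>h x\<bar>" for i
    proof (rule AE_I2)
      fix x
      have "\<bar>F i x\<bar> \<le> 2 * \<bar>h x\<bar>" using F(3)[of i x] by (simp add: dist_real_def)
      then show "\<bar>h x - F i x\<bar> \<le> 3 * \<bar>h x\<bar>" by linarith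
    qed
    have "Lq_norm past_law q (\<lambda>x. 3 * \<bar>h x\<bar>) \<le> ennreal (\<bar>3\<bar> * a)"
      using q a by (intro Lq_norm_cmult) (auto intro: Lq_norm_mono_AE[where g = h])
    then show "Lq_norm past_law q (\<lambda>x. 3 * \<bar>h x\<bar>) < \<infinity>"
      using ennreal_less_top le_less_trans by fastforce
  qed (use q \<open>0 < \<delta>\<close> hL in auto)
  \<comment> \<open>One third of \<open>\<delta>\<close> pays for \<open>h - F i\<close>, the other
    two for the difference of the means, which \<open>Lq_norm_expectation\<close> bounds with a
    factor 2.\<close>
  then obtain i where i: "Lq_norm past_law q (\<lambda>x. h x - F i x) \<le> ennreal (\<delta> / 3)" by blast
  define A where "A y = F i -` {y}" for y
  have A: "A y \<in> sets past_space" for y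
    using measurable_sets[OF FL, of "{y}" i] by (simp add: A_def)
  have finF: "finite (range (F i))" using F(1)[of i] by (auto simp: simple_function_def)
  define g where "g x = (\<Sum>y\<in>range (F i). y * (indicator (A y) x - measure past_law (A y)))" for x
  have [measurable]: "g \<in> borel_measurable past_space"
    unfolding g_def[abs_def] using A by measurable
  have "averages_vanish q g"
    unfolding g_def[abs_def] using A
    by (intro averages_vanish_sum q1 finF averages_vanish_cmult averages_vanish_indicator q) auto
  have gF: "g x = F i x - (\<Sum>y\<in>range (F i). y * measure past_law (A y))" for x
  proof -
    have "(\<Sum>y\<in>range (F i). y * indicator (A y) x) = (\<Sum>y\<in>range (F i). if y = F i x then y else 0)"
      by (intro sum.cong) (auto simp: A_def indicator_def)
    also have "\<dots> = F i x" using finF by simp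
    finally show ?thesis by (simp add: g_def right_diff_distrib sum_subtractf)
  qed
  have int: "integrable past_law h" using L.Lq_norm_expectation(1)[OF q1 hL a(2,1)] .
  have diff: "integrable past_law (\<lambda>x. h x - F i x)" "\<bar>LINT x|past_law. h x - F i x\<bar> \<le> 2 * (\<delta> / 3)"
    using L.Lq_norm_expectation[OF q1 _ _ i] hL \<open>0 < \<delta>\<close> by auto
  have intF: "integrable past_law (F i)"
    using Bochner_Integration.integrable_diff[OF int diff(1)] by simp
  have "(LINT x|past_law. g x) = 0"
    unfolding g_def using A L.prob_space by (simp add: L.emeasure_eq_measure)
  then have "(LINT x|past_law. F i x) = (\<Sum>y\<in>range (F i). y * measure past_law (A y))"
    unfolding gF using intF L.prob_space by simp
  then have eq: "h x - (LINT y|past_law. h y) - g x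
      = (h x - F i x) + - (LINT x|past_law. h x - F i x)" for x
    using int intF by (simp add: gF)
  have "Lq_norm past_law q (\<lambda>x. (h x - F i x) + - (LINT x|past_law. h x - F i x))
      \<le> ennreal (\<delta> / 3 + 2 * (\<delta> / 3))"
  proof (rule Lq_norm_add[OF q1])
    show "Lq_norm past_law q (\<lambda>x. - (LINT x|past_law. h x - F i x)) \<le> ennreal (2 * (\<delta> / 3))"
      using diff(2) q by (intro order_trans[OF L.Lq_norm_const ennreal_leI]) auto
  qed (use i hL \<open>0 < \<delta>\<close> in auto)
  then have "Lq_norm past_law q (\<lambda>x. h x - (LINT y|past_law. h y) - g x) \<le> ennreal \<delta>"
    unfolding eq by (simp add: algebra_simps)
  then show "\<exists>g \<in> borel_measurable past_space. averages_vanish q g \<and>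
      Lq_norm past_law q (\<lambda>x. h x - (LINT y|past_law. h y) - g x) \<le> ennreal \<delta>"
    using \<open>averages_vanish q g\<close> by (intro bexI[of _ g] conjI) simp_all
qed (use q in auto)

end

section \<open>Moduli of continuity and Taylor remainders of paths\<close>

text \<open>The suprema run over rationals to keep the modulus of a random function measurable.\<close>

definition rat_modulus :: "(real \<Rightarrow> real) \<Rightarrow> real \<Rightarrow> real" where
  "rat_modulus d \<delta> = enn2real (SUP r\<in>\<rat> \<inter> {0..1}. SUP s\<in>\<rat> \<inter> {0..1}.
     if \<bar>r - s\<bar> < \<delta> then ennreal \<bar>d r - d s\<bar> else 0)"

lemma rat_modulus_nonneg: "0 \<le> rat_modulus d \<delta>"
  by (simp add: rat_modulus_def)

lemma rat_modulus_cong: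
  assumes "\<And>r. r \<in> \<rat> \<inter> {0..1} \<Longrightarrow> d r = d' r"
  shows "rat_modulus d \<delta> = rat_modulus d' \<delta>"
  unfolding rat_modulus_def using assms by (intro arg_cong[where f = enn2real] SUP_cong) auto

lemma measurable_rat_modulus:
  assumes "\<And>r. r \<in> \<rat> \<inter> {0..1} \<Longrightarrow> f r \<in> borel_measurable N"
  shows "(\<lambda>x. rat_modulus (\<lambda>r. f r x) \<delta>) \<in> borel_measurable N"
proof -
  have [simp]: "countable (\<rat> \<inter> {0..1::real})" using countable_rat by blast
  have "(\<lambda>x. if \<bar>r - s\<bar> < \<delta> then ennreal \<bar>f r x - f s x\<bar> else 0) \<in> borel_measurable N"
    if "r \<in> \<rat> \<inter> {0..1}" "s \<in> \<rat> \<inter> {0..1}" for r s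
    using assms[OF that(1)] assms[OF that(2)] by (cases "\<bar>r - s\<bar> < \<delta>") simp_all
  then have "(\<lambda>x. SUP r\<in>\<rat> \<inter> {0..1}. SUP s\<in>\<rat> \<inter> {0..1}.
      if \<bar>r - s\<bar> < \<delta> then ennreal \<bar>f r x - f s x\<bar> else 0) \<in> borel_measurable N"
    by (intro borel_measurable_SUP) simp_all
  then show ?thesis unfolding rat_modulus_def by measurable
qed

lemma rat_modulus_le:
  assumes "0 \<le> c" and "\<And>r s. r \<in> {0..1} \<Longrightarrow> s \<in> {0..1} \<Longrightarrow> \<bar>r - s\<bar> < \<delta> \<Longrightarrow> \<bar>d r - d s\<bar> \<le> c"
  shows "rat_modulus d \<delta> \<le> c"
  unfolding rat_modulus_def using assms
  by (intro enn2real_leI SUP_least) (auto intro: ennreal_leI)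

text \<open>Continuity enters twice. It bounds \<open>d\<close>, so the supremum is finite and is
  not sent to 0 by \<open>enn2real\<close>; and it extends the bound from rational pairs to all
  pairs. The strict inequality \<open>\<bar>r - s\<bar> < \<delta>\<close> is an open condition and
  so passes to the approximating rationals.\<close>

lemma rat_modulus_ge:
  assumes cont: "continuous_on {0..1} d" and rs: "r \<in> {0..1}" "s \<in> {0..1}" "\<bar>r - s\<bar> < \<delta>"
  shows "\<bar>d r - d s\<bar> \<le> rat_modulus d \<delta>"
proof -
  let ?R = "\<rat> \<inter> {0..1::real}"
  define w where "w = (SUP r\<in>?R. SUP s\<in>?R. if \<bar>r - s\<bar> < \<delta> then ennreal \<bar>d r - d s\<bar> else 0)"
  obtain B where "\<forall>z\<in>d ` {0..1}. norm z \<le> B"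
    using compact_imp_bounded[OF compact_continuous_image[OF cont]] unfolding bounded_iff by auto
  then have B: "\<bar>d u\<bar> \<le> B" if "u \<in> {0..1}" for u using that by auto
  have "0 \<le> B" using B[of 0] by simp
  have "w \<le> ennreal (2 * B)"
    unfolding w_def
  proof (intro SUP_least)
    fix r s assume "r \<in> ?R" "s \<in> ?R"
    then have "\<bar>d r - d s\<bar> \<le> 2 * B" using B[of r] B[of s] by auto
    then show "(if \<bar>r - s\<bar> < \<delta> then ennreal \<bar>d r - d s\<bar> else 0) \<le> ennreal (2 * B)"
      by (auto intro: ennreal_leI)
  qed
  then have "w < top" using ennreal_less_top le_less_trans by blast
  have rat: "\<bar>d r - d s\<bar> \<le> rat_modulus d \<delta>" if "r \<in> ?R" "s \<in> ?R" "\<bar>r - s\<bar> < \<delta>" for r s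
  proof -
    have "ennreal \<bar>d r - d s\<bar> \<le> w"
      unfolding w_def using that by (intro SUP_upper2[of r] SUP_upper2[of s]) auto
    also have "w = ennreal (rat_modulus d \<delta>)"
      unfolding rat_modulus_def w_def[symmetric] using \<open>w < top\<close> by simp
    finally show ?thesis by (simp add: rat_modulus_nonneg)
  qed
  have approx: "\<exists>x. (\<forall>n. x n \<in> ?R) \<and> x \<longlonglongrightarrow> u" if "u \<in> {0..1}" for u
  proof -
    \<comment> \<open>Rounding down to multiples of \<open>1 / (n + 1)\<close> keeps the
      approximants in [0,1], also at the endpoints.\<close>
    define x where "x n = of_int \<lfloor>u * real (Suc n)\<rfloor> / real (Suc n)" for n
    have x: "x n \<le> u" "u - 1 / real (Suc n) \<le> x n" "0 \<le> x n" for n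
    proof -
      have "of_int \<lfloor>u * real (Suc n)\<rfloor> \<le> u * real (Suc n)"
        "u * real (Suc n) - 1 \<le> of_int \<lfloor>u * real (Suc n)\<rfloor>" "0 \<le> \<lfloor>u * real (Suc n)\<rfloor>"
        using that by (linarith, linarith, simp)
      then show "x n \<le> u" "u - 1 / real (Suc n) \<le> x n" "0 \<le> x n"
        using divide_right_mono[of "u * real (Suc n) - 1" "of_int \<lfloor>u * real (Suc n)\<rfloor>" "real (Suc n)"]
        unfolding x_def by (simp_all add: divide_le_eq diff_divide_distrib del: of_nat_Suc)
    qed
    have "x \<longlonglongrightarrow> u"
    proof (rule tendsto_sandwich[OF _ _ _ tendsto_const])
      have "(\<lambda>n. u - 1 / real (Suc n)) \<longlonglongrightarrow> u - 0"
        using LIMSEQ_inverse_real_of_nat by (intro tendsto_diff tendsto_const) (simp add: inverse_eq_divide)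
      then show "(\<lambda>n. u - 1 / real (Suc n)) \<longlonglongrightarrow> u" by simp
    qed (use x in \<open>auto intro!: always_eventually\<close>)
    moreover have "x n \<in> ?R" for n
    proof -
      have "x n \<in> \<rat>" by (simp add: x_def)
      moreover have "x n \<le> 1" using x(1)[of n] that by simp
      ultimately show ?thesis using x(3)[of n] by simp
    qed
    ultimately show ?thesis by blast
  qed
  obtain x where x: "\<And>n. x n \<in> ?R" "x \<longlonglongrightarrow> r" using approx[OF rs(1)] by blast
  obtain y where y: "\<And>n. y n \<in> ?R" "y \<longlonglongrightarrow> s" using approx[OF rs(2)] by blast
  have "(\<lambda>n. d (x n)) \<longlonglongrightarrow> d r" "(\<lambda>n. d (y n)) \<longlonglongrightarrow> d s"
    using x y rs by (auto intro!: continuous_on_tendsto_compose[OF cont])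
  then have lim: "(\<lambda>n. \<bar>d (x n) - d (y n)\<bar>) \<longlonglongrightarrow> \<bar>d r - d s\<bar>" by (intro tendsto_intros)
  have "(\<lambda>n. \<bar>x n - y n\<bar>) \<longlonglongrightarrow> \<bar>r - s\<bar>" using x y by (intro tendsto_intros)
  then have "\<forall>\<^sub>F n in sequentially. \<bar>x n - y n\<bar> < \<delta>" using rs(3) by (rule order_tendstoD)
  then have "\<forall>\<^sub>F n in sequentially. \<bar>d (x n) - d (y n)\<bar> \<le> rat_modulus d \<delta>"
    by eventually_elim (use rat x(1) y(1) in blast)
  then show ?thesis using lim tendsto_upperbound by (metis trivial_limit_sequentially)
qed

lemma rat_modulus_tendsto_zero:
  assumes "continuous_on {0..1} d"
  shows "(\<lambda>i. rat_modulus d (1 / real (Suc i))) \<longlonglongrightarrow> 0"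
proof (rule LIMSEQ_I)
  fix \<epsilon> :: real assume "0 < \<epsilon>"
  have "uniformly_continuous_on {0..1} d" using assms by (rule compact_uniformly_continuous) simp
  then obtain \<delta> where "0 < \<delta>" and \<delta>: "\<And>r s. r \<in> {0..1} \<Longrightarrow> s \<in> {0..1} \<Longrightarrow> \<bar>r - s\<bar> < \<delta> \<Longrightarrow> \<bar>d r - d s\<bar> < \<epsilon> / 2"
    using half_gt_zero[OF \<open>0 < \<epsilon>\<close>] unfolding uniformly_continuous_on_def dist_real_def by metis
  obtain N where N: "1 / real (Suc N) < \<delta>" using \<open>0 < \<delta>\<close> nat_approx_posE by blast
  have "norm (rat_modulus d (1 / real (Suc i)) - 0) < \<epsilon>" if "i \<ge> N" for i
  proof -
    have "1 / real (Suc i) \<le> 1 / real (Suc N)" using that by (simp add: frac_le)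
    then have "rat_modulus d (1 / real (Suc i)) \<le> \<epsilon> / 2"
      using N \<open>0 < \<epsilon>\<close> \<delta> by (intro rat_modulus_le) (auto intro: less_imp_le)
    then show ?thesis using rat_modulus_nonneg[of d "1 / real (Suc i)"] \<open>0 < \<epsilon>\<close> by simp
  qed
  then show "\<exists>N. \<forall>i\<ge>N. norm (rat_modulus d (1 / real (Suc i)) - 0) < \<epsilon>" by blast
qed

text \<open>Mean value inequality for \<open>y x - x * d u\<close>, whose derivative is
  \<open>d x - d u\<close>, on the segment from \<open>u\<close> to \<open>v\<close>; only there is
  the bound \<open>c\<close> at hand.\<close>

lemma derivative_remainder_le:
  fixes y d :: "real \<Rightarrow> real"
  assumes der: "\<And>x. x \<in> {0..1} \<Longrightarrow> (y has_vector_derivative d x) (at x within {0..1})"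
    and uv: "u \<in> {0..1}" "v \<in> {0..1}" "\<bar>v - u\<bar> < \<delta>"
    and d: "\<And>s. s \<in> {0..1} \<Longrightarrow> \<bar>s - u\<bar> < \<delta> \<Longrightarrow> \<bar>d s - d u\<bar> \<le> c"
  shows "\<bar>y v - y u - (v - u) * d u\<bar> \<le> \<bar>v - u\<bar> * c"
proof -
  let ?S = "closed_segment u v"
  have S: "?S \<subseteq> {0..1}" using uv closed_segment_subset[of u "{0..1}" v] by simp
  have S\<delta>: "\<bar>s - u\<bar> < \<delta>" if "s \<in> ?S" for s
    using that uv(3) segment_bound1[OF that] by (simp add: dist_real_def)
  have "norm ((y v - v * d u) - (y u - u * d u)) \<le> c * norm (v - u)"
  proof (rule field_differentiable_bound[of ?S "\<lambda>x. y x - x * d u" "\<lambda>x. d x - d u"])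
    fix x assume x: "x \<in> ?S"
    then have "(y has_field_derivative d x) (at x within ?S)"
      using der S has_field_derivative_subset has_real_derivative_iff_has_vector_derivative by blast
    then show "((\<lambda>x. y x - x * d u) has_field_derivative d x - d u) (at x within ?S)"
      by (auto intro!: derivative_eq_intros)
    show "norm (d x - d u) \<le> c" using d[of x] S S\<delta>[OF x] x by auto
  qed auto
  then show ?thesis by (simp add: algebra_simps)
qed

section \<open>Kernel sums on the grid\<close>

text \<open>An interval without integers still needs a nonnegative bound, hence
  \<open>a \<le> d + 1\<close>.\<close>

lemma card_int_between_le:
  fixes a d :: real
  assumes "a \<le> d + 1"
  shows "finite {t::int. a \<le> of_int t \<and> of_int t \<le> d}"
    and "card {t::int. a \<le> of_int t \<and> of_int t \<le> d} \<le> d - a + 1"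
proof -
  have eq: "{t::int. a \<le> of_int t \<and> of_int t \<le> d} = {\<lceil>a\<rceil>..\<lfloor>d\<rfloor>}"
    by (auto simp: ceiling_le_iff le_floor_iff)
  then show "finite {t::int. a \<le> of_int t \<and> of_int t \<le> d}" by simp
  show "card {t::int. a \<le> of_int t \<and> of_int t \<le> d} \<le> d - a + 1"
  proof (cases "\<lceil>a\<rceil> \<le> \<lfloor>d\<rfloor> + 1")
    case True
    then have "real (card {t::int. a \<le> of_int t \<and> of_int t \<le> d}) = of_int \<lfloor>d\<rfloor> - of_int \<lceil>a\<rceil> + 1"
      unfolding eq by simp
    also have "\<dots> \<le> d - a + 1" using of_int_floor_le[of d] le_of_int_ceiling[of a] by linarith
    finally show ?thesis .
  qed (use assms in \<open>simp add: eq\<close>)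
qed

text \<open>Interleaving \<open>y k\<close> and \<open>y k + \<theta>\<close> gives one monotone
  sequence; the sum picks every second increment of its variation.\<close>

lemma sum_double_step_variation_le:
  fixes f y :: "_ \<Rightarrow> real"
  assumes V: "\<And>N x. mono_on {..N::nat} x \<Longrightarrow> (\<Sum>i<N. \<bar>f (x (Suc i)) - f (x i)\<bar>) \<le> V"
    and "0 \<le> \<theta>" and y: "\<And>k. y k + \<theta> \<le> y (Suc k)"
  shows "(\<Sum>k<m. \<bar>f (y k + \<theta>) - f (y k)\<bar>) \<le> V"
proof -
  define x where "x k = (if even k then y (k div 2) else y (k div 2) + \<theta>)" for k :: nat
  have "x k \<le> x (Suc k)" for k
    using \<open>0 \<le> \<theta>\<close> y[of "k div 2"] by (cases "even k") (auto simp: x_def)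
  then have "mono x" by (simp add: mono_iff_le_Suc)
  from V[OF mono_on_subset[OF this]] have "(\<Sum>i<2 * m. \<bar>f (x (Suc i)) - f (x i)\<bar>) \<le> V"
    by simp
  moreover have "(\<Sum>k<m. \<bar>f (y k + \<theta>) - f (y k)\<bar>) \<le> (\<Sum>i<2 * m. \<bar>f (x (Suc i)) - f (x i)\<bar>)"
    by (induction m) (auto simp: x_def intro!: add_increasing2)
  ultimately show ?thesis by linarith
qed

text \<open>The reflection \<open>t \<mapsto> \<lfloor>2un\<rfloor> - t\<close> maps the grid \<open>(t/n - u)/b\<close> to its negative up to a shift
  \<open>\<theta>\<close> smaller than the mesh. Since \<open>y K(y)\<close> is odd, twice the sum telescopes against the variation of \<open>K\<close>.\<close>

lemma kernel_first_moment_sum_bounded: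
  fixes K :: "real \<Rightarrow> real"
  assumes V: "\<And>N x. mono_on {..N::nat} x \<Longrightarrow> (\<Sum>i<N. \<bar>K (x (Suc i)) - K (x i)\<bar>) \<le> V"
    and bnd: "\<And>x. \<bar>K x\<bar> \<le> \<kappa>"
    and supp: "\<And>x. K x \<noteq> 0 \<Longrightarrow> \<bar>x\<bar> \<le> 1 / 2"
    and even: "\<And>x. K (- x) = K x"
    and b: "0 < b" "1 \<le> real n * b" and u: "b / 2 \<le> u" "u \<le> 1 - b / 2"
  shows "\<bar>\<Sum>t=1..n. ((real t / real n - u) / b) * K ((real t / real n - u) / b)\<bar> \<le> V + 2 * \<kappa>"
proof -
  have n: "0 < real n" using b by (metis mult_zero_left not_one_le_zero of_nat_0_less_iff of_nat_0 neq0_conv)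
  define y where "y t = (of_int t / real n - u) / b" for t :: int
  define c where "c = \<lfloor>2 * u * real n\<rfloor>"
  define \<theta> where "\<theta> = (2 * u - of_int c / real n) / b"
  define h where "h = 1 / (real n * b)"
  have h: "0 < h" "h \<le> 1" using b n by (auto simp: h_def)
  have c: "of_int c \<le> 2 * u * real n" "2 * u * real n < of_int c + 1"
    unfolding c_def by linarith+
  have "0 \<le> 2 * u * real n" "2 * u * real n \<le> 2 * real n" using u b n by auto
  then have c': "0 \<le> c" "c \<le> 2 * int n" unfolding c_def
    by (simp, metis floor_mono floor_of_int of_int_mult of_int_numeral of_int_of_nat_eq)
  have \<theta>: "0 \<le> \<theta>" "\<theta> \<le> h"
  proof -
    have "of_int c / real n \<le> 2 * u" using c n by (simp add: divide_le_eq)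
    then show "0 \<le> \<theta>" using b by (simp add: \<theta>_def)
    have "2 * u - of_int c / real n = (2 * u * real n - of_int c) / real n" using n by (simp add: field_simps)
    also have "\<dots> \<le> 1 / real n" using c n by (intro divide_right_mono) auto
    finally have "2 * u - of_int c / real n \<le> 1 / real n" .
    then have "\<theta> \<le> (1 / real n) / b" unfolding \<theta>_def using b by (intro divide_right_mono) auto
    then show "\<theta> \<le> h" by (simp add: h_def)
  qed
  have refl: "y (c - t) = - (y t + \<theta>)" for t
    using b n by (simp add: y_def \<theta>_def field_simps)
  have step: "y (t + 1) = y t + h" for t
    using b n by (simp add: y_def h_def field_simps)
  \<comment> \<open>Invariant under \<open>t \<mapsto> c - t\<close>, and large enough to contain
    \<open>{0..int n}\<close> because \<open>0 \<le> c \<le> 2 * int n\<close>.\<close>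
  define T where "T = {c - 2 * int n..2 * int n}"
  have finT: "finite T" by (simp add: T_def)
  define A where "A = (\<Sum>t\<in>T. y t * K (y t))"
  have "A = (\<Sum>t\<in>T. y (c - t) * K (y (c - t)))"
    unfolding A_def by (rule sum.reindex_bij_witness[of _ "\<lambda>t. c - t" "\<lambda>t. c - t"]) (auto simp: T_def)
  then have twoA: "2 * A = (\<Sum>t\<in>T. y t * K (y t) - (y t + \<theta>) * K (y t + \<theta>))"
    unfolding refl even mult_minus_left sum_negf by (simp add: A_def sum_subtractf)
  have "\<bar>2 * A\<bar> \<le> (\<Sum>t\<in>T. 3 / 2 * \<bar>K (y t + \<theta>) - K (y t)\<bar> + (if \<bar>y t + \<theta>\<bar> \<le> 1 / 2 then h * \<kappa> else 0))"
    unfolding twoA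
  proof (intro order_trans[OF sum_abs] sum_mono)
    fix t
    let ?z = "y t + \<theta>"
    \<comment> \<open>A discrete product rule: the first part is charged to the variation of
      \<open>K\<close>, the second to the offset \<open>\<theta>\<close>. The factor 3/2 arises
      because \<open>y t\<close> or \<open>?z\<close> lies within 1/2 of 0 unless both kernel values
      vanish, and the two differ by at most 1.\<close>
    have "y t * K (y t) - ?z * K ?z = y t * (K (y t) - K ?z) - \<theta> * K ?z" by (simp add: algebra_simps)
    then have "\<bar>y t * K (y t) - ?z * K ?z\<bar> \<le> \<bar>y t\<bar> * \<bar>K ?z - K (y t)\<bar> + \<theta> * \<bar>K ?z\<bar>"
      using abs_triangle_ineq4[of "y t * (K (y t) - K ?z)" "\<theta> * K ?z"] \<theta>(1)
      by (simp add: abs_mult abs_minus_commute)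
    moreover have "\<bar>y t\<bar> * \<bar>K ?z - K (y t)\<bar> \<le> 3 / 2 * \<bar>K ?z - K (y t)\<bar>"
    proof (cases "K ?z = 0 \<and> K (y t) = 0")
      case False
      then have "\<bar>?z\<bar> \<le> 1 / 2 \<or> \<bar>y t\<bar> \<le> 1 / 2" using supp by blast
      then have "\<bar>y t\<bar> \<le> 3 / 2" using \<theta> h by linarith
      then show ?thesis by (intro mult_right_mono) auto
    qed simp
    moreover have "\<theta> * \<bar>K ?z\<bar> \<le> (if \<bar>?z\<bar> \<le> 1 / 2 then h * \<kappa> else 0)"
    proof (cases "K ?z = 0")
      case True
      then show ?thesis using bnd[of 0] h by auto
    next
      case False
      then show ?thesis
        using supp[of ?z] \<theta> h by (simp add: mult_mono bnd)
    qed
    ultimately show "\<bar>y t * K (y t) - ?z * K ?z\<bar>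
        \<le> 3 / 2 * \<bar>K ?z - K (y t)\<bar> + (if \<bar>?z\<bar> \<le> 1 / 2 then h * \<kappa> else 0)" by linarith
  qed
  also have "\<dots> = 3 / 2 * (\<Sum>t\<in>T. \<bar>K (y t + \<theta>) - K (y t)\<bar>) + card {t\<in>T. \<bar>y t + \<theta>\<bar> \<le> 1 / 2} * (h * \<kappa>)"
    by (simp only: sum.distrib sum_distrib_left[symmetric] sum.inter_filter[OF finT, symmetric] sum_constant
      mult.left_commute)
  also have "\<dots> \<le> 3 / 2 * V + 2 * \<kappa>"
  proof (intro add_mono mult_left_mono)
    have "(\<Sum>k<card T. \<bar>K (y (c - 2 * int n + int k) + \<theta>) - K (y (c - 2 * int n + int k))\<bar>) \<le> V"
    proof (rule sum_double_step_variation_le[OF V \<theta>(1)])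
      show "y (c - 2 * int n + int k) + \<theta> \<le> y (c - 2 * int n + int (Suc k))" for k
        using step[of "c - 2 * int n + int k"] \<theta>(2) by (simp add: algebra_simps)
    qed
    also have "(\<Sum>k<card T. \<bar>K (y (c - 2 * int n + int k) + \<theta>) - K (y (c - 2 * int n + int k))\<bar>)
        = (\<Sum>t\<in>T. \<bar>K (y t + \<theta>) - K (y t)\<bar>)"
      by (rule sum.reindex_bij_witness[of _ "\<lambda>t. nat (t - (c - 2 * int n))" "\<lambda>k. c - 2 * int n + int k"])
        (use c' in \<open>auto simp: T_def\<close>)
    finally show "(\<Sum>t\<in>T. \<bar>K (y t + \<theta>) - K (y t)\<bar>) \<le> V" .
    have "0 \<le> \<kappa>" using bnd[of 0] by linarith
    \<comment> \<open>The window condition becomes an interval of length \<open>real n * b\<close>,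
      hence at most \<open>real n * b + 1\<close> indices; each costs \<open>h * \<kappa>\<close>
      with \<open>h = 1 / (real n * b) \<le> 1\<close>.\<close>
    define L where "L = {t::int. real n * (u - b * (1 / 2 + \<theta>)) \<le> of_int t \<and> of_int t \<le> real n * (u + b * (1 / 2 - \<theta>))}"
    have diff: "real n * (u + b * (1 / 2 - \<theta>)) - real n * (u - b * (1 / 2 + \<theta>)) = real n * b"
      by (simp add: algebra_simps)
    have "card {t\<in>T. \<bar>y t + \<theta>\<bar> \<le> 1 / 2} \<le> card L"
    proof (rule card_mono)
      show "finite L" unfolding L_def using diff b by (intro card_int_between_le) linarith
      show "{t\<in>T. \<bar>y t + \<theta>\<bar> \<le> 1 / 2} \<subseteq> L"
      proof
        fix t assume "t \<in> {t\<in>T. \<bar>y t + \<theta>\<bar> \<le> 1 / 2}"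
        then have "\<bar>y t + \<theta>\<bar> \<le> 1 / 2" by simp
        then have "- (1 / 2 + \<theta>) \<le> y t" "y t \<le> 1 / 2 - \<theta>" by linarith+
        then have "0 \<le> b * (y t + (1 / 2 + \<theta>))" "0 \<le> b * (1 / 2 - \<theta> - y t)"
          using b by (intro mult_nonneg_nonneg; linarith)+
        then have "u - b * (1 / 2 + \<theta>) \<le> u + b * y t" "u + b * y t \<le> u + b * (1 / 2 - \<theta>)"
          by (simp_all add: algebra_simps)
        then have "real n * (u - b * (1 / 2 + \<theta>)) \<le> real n * (u + b * y t)"
          "real n * (u + b * y t) \<le> real n * (u + b * (1 / 2 - \<theta>))"
          using n by (intro mult_left_mono; simp)+
        moreover have "real_of_int t = real n * (u + b * y t)" using b n by (simp add: y_def)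
        ultimately show "t \<in> L" unfolding L_def by (simp only: mem_Collect_eq)
      qed
    qed
    also have "real (card L) \<le> real n * b + 1"
      unfolding L_def diff[symmetric] using diff b by (intro card_int_between_le) linarith
    finally have "card {t\<in>T. \<bar>y t + \<theta>\<bar> \<le> 1 / 2} * (h * \<kappa>) \<le> (real n * b + 1) * (h * \<kappa>)"
      using h \<open>0 \<le> \<kappa>\<close> by (intro mult_right_mono) auto
    also have "\<dots> = \<kappa> + h * \<kappa>" using b n by (simp add: h_def field_simps)
    also have "\<dots> \<le> 2 * \<kappa>" using h \<open>0 \<le> \<kappa>\<close> mult_right_mono[of h 1 \<kappa>] by simp
    finally show "card {t\<in>T. \<bar>y t + \<theta>\<bar> \<le> 1 / 2} * (h * \<kappa>) \<le> 2 * \<kappa>" .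
  qed simp
  finally have A: "\<bar>2 * A\<bar> \<le> 3 / 2 * V + 2 * \<kappa>" .
  have "0 \<le> V" using V[of 0 "\<lambda>_. 0"] by (simp add: mono_on_def)
  \<comment> \<open>Since \<open>u\<close> keeps distance \<open>b / 2\<close> from both endpoints,
    every nonzero term has its index in \<open>{0..int n}\<close>. The surplus index 0 contributes
    at most \<open>\<kappa> / 2\<close>; with
    \<open>\<bar>A\<bar> \<le> 3 / 4 * V + \<kappa>\<close> the total stays within
    \<open>V + 2 * \<kappa>\<close>.\<close>
  have "A = (\<Sum>t\<in>{0..int n}. y t * K (y t))"
    unfolding A_def
  proof (rule sum.mono_neutral_right)
    show "\<forall>t\<in>T - {0..int n}. y t * K (y t) = 0"
    proof
      fix t assume t: "t \<in> T - {0..int n}"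
      have "\<not> \<bar>y t\<bar> \<le> 1 / 2"
      proof
        assume "\<bar>y t\<bar> \<le> 1 / 2"
        then have "0 \<le> of_int t / real n" "of_int t / real n \<le> 1"
        proof -
          have "\<bar>of_int t / real n - u\<bar> \<le> b / 2"
            using \<open>\<bar>y t\<bar> \<le> 1 / 2\<close> b by (simp add: y_def abs_divide field_simps)
          then show "0 \<le> of_int t / real n" "of_int t / real n \<le> 1" using u by linarith+
        qed
        then have "0 \<le> real_of_int t" "real_of_int t \<le> real n"
          using n by (auto simp: field_simps zero_le_divide_iff)
        then show False using t by auto
      qed
      then show "y t * K (y t) = 0" using supp by auto
    qed
  qed (use c' in \<open>auto simp: T_def\<close>)
  also have "{0..int n} = insert 0 {1..int n}" by auto
  also have "(\<Sum>t\<in>insert 0 {1..int n}. y t * K (y t)) = y 0 * K (y 0) + (\<Sum>t=1..int n. y t * K (y t))"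
    by simp
  also have "(\<Sum>t=1..int n. y t * K (y t)) = (\<Sum>t=1..n. y (int t) * K (y (int t)))"
    by (rule sum.reindex_bij_witness[of _ int nat]) auto
  finally have "A = y 0 * K (y 0) + (\<Sum>t=1..n. y (int t) * K (y (int t)))" .
  moreover have "\<bar>y 0 * K (y 0)\<bar> \<le> 1 / 2 * \<kappa>"
  proof (cases "K (y 0) = 0")
    case False
    then show ?thesis unfolding abs_mult using supp bnd by (intro mult_mono) auto
  qed (use bnd[of 0] in auto)
  ultimately have "\<bar>\<Sum>t=1..n. y (int t) * K (y (int t))\<bar> \<le> V + 2 * \<kappa>"
    using A \<open>0 \<le> V\<close> bnd[of 0] by linarith
  then show ?thesis by (simp add: y_def)
qed

text \<open>The support window contains at most \<open>real n * b + 1\<close> grid points.\<close>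

lemma kernel_weight_sum_le:
  fixes K :: "real \<Rightarrow> real"
  assumes bnd: "\<And>x. \<bar>K x\<bar> \<le> \<kappa>" and supp: "\<And>x. K x \<noteq> 0 \<Longrightarrow> \<bar>x\<bar> \<le> 1 / 2"
    and b: "0 < b" "0 < n"
  shows "(\<Sum>t=1..n. \<bar>K ((real t / real n - u) / b)\<bar>) \<le> \<kappa> * (real n * b + 1)"
proof -
  define y where "y t = (real t / real n - u) / b" for t :: nat
  define L where "L = {t::int. real n * (u - b / 2) \<le> of_int t \<and> of_int t \<le> real n * (u + b / 2)}"
  have len: "real n * (u + b / 2) - real n * (u - b / 2) = real n * b" by (simp add: algebra_simps)
  have "0 \<le> \<kappa>" using bnd[of 0] by simp
  have "(\<Sum>t=1..n. \<bar>K (y t)\<bar>) \<le> (\<Sum>t=1..n. if \<bar>y t\<bar> \<le> 1 / 2 then \<kappa> else 0)"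
  proof (rule sum_mono)
    show "\<bar>K (y t)\<bar> \<le> (if \<bar>y t\<bar> \<le> 1 / 2 then \<kappa> else 0)" for t
      using bnd[of "y t"] supp[of "y t"] by (cases "K (y t) = 0") (simp_all add: \<open>0 \<le> \<kappa>\<close>)
  qed
  also have "\<dots> = card {t\<in>{1..n}. \<bar>y t\<bar> \<le> 1 / 2} * \<kappa>"
    by (simp only: sum.inter_filter[OF finite_atLeastAtMost, symmetric] sum_constant)
  also have "\<dots> \<le> (real n * b + 1) * \<kappa>"
  proof (intro mult_right_mono \<open>0 \<le> \<kappa>\<close>)
    have "card (int ` {t\<in>{1..n}. \<bar>y t\<bar> \<le> 1 / 2}) \<le> card L"
    proof (rule card_mono)
      have "0 \<le> real n * b" using b by simp
      then show "finite L" unfolding L_def using len by (intro card_int_between_le) linarith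
      show "int ` {t\<in>{1..n}. \<bar>y t\<bar> \<le> 1 / 2} \<subseteq> L"
      proof
        fix s assume "s \<in> int ` {t\<in>{1..n}. \<bar>y t\<bar> \<le> 1 / 2}"
        then obtain t where t: "s = int t" "\<bar>y t\<bar> \<le> 1 / 2" by auto
        have "\<bar>real t / real n - u\<bar> \<le> b / 2"
          using t(2) b by (simp add: y_def abs_divide field_simps)
        then have "u - b / 2 \<le> real t / real n" "real t / real n \<le> u + b / 2" by linarith+
        then show "s \<in> L" using b by (simp add: t(1) L_def field_simps)
      qed
    qed
    then have "real (card {t\<in>{1..n}. \<bar>y t\<bar> \<le> 1 / 2}) \<le> card L" by (simp add: card_image)
    also have "\<dots> \<le> real n * b + 1"
    proof -
      have "0 \<le> real n * b" using b by simp
      then show ?thesis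
        unfolding L_def len[symmetric] using len by (intro card_int_between_le) linarith
    qed
    finally show "real (card {t\<in>{1..n}. \<bar>y t\<bar> \<le> 1 / 2}) \<le> real n * b + 1" .
  qed
  finally show ?thesis by (simp add: y_def mult.commute)
qed

context iid_past
begin

lemma averages_leD_nat:
  assumes av: "averages_le q h S \<eta> \<epsilon>" and "(\<Sum>t=1..n. \<bar>w t\<bar>) \<le> S" "\<And>t. \<bar>w t\<bar> \<le> \<eta>"
  shows "Lq_norm M q (\<lambda>\<omega>. \<Sum>t=1..n. w t * h (past e (int t) \<omega>)) \<le> ennreal \<epsilon>"
proof -
  have reidx: "(\<Sum>t\<in>int ` {1..n}. f t) = (\<Sum>t=1..n. f (int t))" for f :: "int \<Rightarrow> real"
    by (simp add: sum.reindex)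
  show ?thesis
    using averages_leD[OF av, of "int ` {1..n}" "\<lambda>t. w (nat t)"] assms(2,3) unfolding reidx by simp
qed

end

section \<open>The derivative process as a function of the past\<close>

text \<open>\<open>D u\<close> is a version of the derivative for each fixed \<open>u\<close>;
  regularity in \<open>u\<close> is a property of the paths of \<open>du Y\<close>. The moment bound
  is stated at time 0 because \<open>past_law\<close> carries norms to all other times.\<close>

locale smooth_past = iid_past M e for M :: "'a measure" and e +
  fixes q :: real and Y :: "int \<Rightarrow> real \<Rightarrow> 'a \<Rightarrow> real" and D :: "real \<Rightarrow> (nat \<Rightarrow> real) \<Rightarrow> real"
  assumes q: "2 \<le> q"
    and Y_measurable: "\<And>t u. u \<in> {0..1} \<Longrightarrow> Y t u \<in> borel_measurable M"
    and D_measurable: "\<And>u. u \<in> {0..1} \<Longrightarrow> D u \<in> borel_measurable past_space"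
    and du_eq: "\<And>t u. u \<in> {0..1} \<Longrightarrow> AE \<omega> in M. du Y t u \<omega> = D u (past e t \<omega>)"
    and diff: "\<And>t. AE \<omega> in M. (\<lambda>v. Y t v \<omega>) differentiable_on {0..1} \<and>
                 continuous_on {0..1} (\<lambda>u. du Y t u \<omega>)"
    and sup: "Lq_norm M q (\<lambda>\<omega>. SUP u\<in>{0..1}. \<bar>du Y 0 u \<omega>\<bar>) < \<infinity>"
begin

lemma q0: "0 < q" and q1: "1 \<le> q" using q by simp_all

text \<open>Built from \<open>D\<close> and not from the paths of \<open>du Y\<close>, so that it is
  a measurable function of the past with a norm independent of time.\<close>

definition osc :: "real \<Rightarrow> (nat \<Rightarrow> real) \<Rightarrow> real" where
  "osc \<delta> x = rat_modulus (\<lambda>r. D r x) \<delta>"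

lemma measurable_osc [measurable]: "osc \<delta> \<in> borel_measurable past_space"
  unfolding osc_def[abs_def] by (intro measurable_rat_modulus D_measurable) simp

lemma osc_nonneg: "0 \<le> osc \<delta> x"
  by (simp add: osc_def rat_modulus_nonneg)

text \<open>For each \<open>r\<close>, \<open>D r\<close> matches the derivative process off a null
  set. Over the countably many rationals these unite to one null set, off which both moduli agree
  for every \<open>\<delta>\<close>.\<close>

lemma AE_osc:
  "AE \<omega> in M. (\<lambda>v. Y t v \<omega>) differentiable_on {0..1} \<and> continuous_on {0..1} (\<lambda>u. du Y t u \<omega>) \<and>
     (\<forall>\<delta>. osc \<delta> (past e t \<omega>) = rat_modulus (\<lambda>u. du Y t u \<omega>) \<delta>)"
proof -
  have "countable (\<rat> \<inter> {0..1::real})" using countable_rat by blast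
  then have "AE \<omega> in M. \<forall>r\<in>\<rat> \<inter> {0..1}. du Y t r \<omega> = D r (past e t \<omega>)"
    by (subst AE_ball_countable) (auto intro: du_eq)
  then show ?thesis
    using diff[of t]
  proof eventually_elim
    case (elim \<omega>)
    then have "osc \<delta> (past e t \<omega>) = rat_modulus (\<lambda>u. du Y t u \<omega>) \<delta>" for \<delta>
      unfolding osc_def by (intro rat_modulus_cong) simp
    then show ?case using elim by blast
  qed
qed

lemma sup_du_ge:
  assumes "continuous_on {0..1} (\<lambda>u. du Y t u \<omega>)" "r \<in> {0..1}"
  shows "\<bar>du Y t r \<omega>\<bar> \<le> (SUP u\<in>{0..1}. \<bar>du Y t u \<omega>\<bar>)"
proof (rule cSUP_upper)
  have "compact ((\<lambda>u. \<bar>du Y t u \<omega>\<bar>) ` {0..1})"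
    using assms by (intro compact_continuous_image continuous_intros) auto
  then show "bdd_above ((\<lambda>u. \<bar>du Y t u \<omega>\<bar>) ` {0..1})"
    by (intro bounded_imp_bdd_above compact_imp_bounded)
qed (use assms in auto)

lemma D_bounded: "\<exists>B\<ge>0. \<forall>u\<in>{0..1}. Lq_norm past_law q (D u) \<le> ennreal B"
proof -
  obtain B where B: "0 \<le> B" "Lq_norm M q (\<lambda>\<omega>. SUP u\<in>{0..1}. \<bar>du Y 0 u \<omega>\<bar>) \<le> ennreal B"
    using sup by (cases "Lq_norm M q (\<lambda>\<omega>. SUP u\<in>{0..1}. \<bar>du Y 0 u \<omega>\<bar>)") auto
  have "Lq_norm past_law q (D u) \<le> ennreal B" if u: "u \<in> {0..1}" for u
  proof -
    have "AE \<omega> in M. \<bar>D u (past e 0 \<omega>)\<bar> \<le> \<bar>SUP u\<in>{0..1}. \<bar>du Y 0 u \<omega>\<bar>\<bar>"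
      using du_eq[OF u, of 0] diff[of 0]
    proof eventually_elim
      case (elim \<omega>)
      then show ?case using sup_du_ge[OF _ u, of 0 \<omega>] by linarith
    qed
    from Lq_norm_mono_AE[OF q0 this B] have "Lq_norm M q (\<lambda>\<omega>. D u (past e 0 \<omega>)) \<le> ennreal B" .
    then show ?thesis using Lq_norm_past[OF D_measurable[OF u], of q 0] by simp
  qed
  then show ?thesis using B(1) by blast
qed

text \<open>Dominated convergence along \<open>\<delta> = 1 / (i + 1)\<close>. The majorant is
  \<open>osc 2\<close>: points of [0,1] are always closer than 2, so it bounds every
  \<open>osc\<close>, and it is at most twice the supremum of the derivative, almost surely.\<close>

lemma osc_small:
  assumes "0 < \<epsilon>"
  shows "\<exists>\<delta>>0. Lq_norm past_law q (osc \<delta>) \<le> ennreal \<epsilon>"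
proof -
  have "\<exists>N. \<forall>i\<ge>N. Lq_norm M q (\<lambda>\<omega>. osc (1 / real (Suc i)) (past e 0 \<omega>)) \<le> ennreal \<epsilon>"
  proof (rule Lq_norm_dominated[where g = "\<lambda>\<omega>. osc 2 (past e 0 \<omega>)"])
    show "AE \<omega> in M. (\<lambda>i. osc (1 / real (Suc i)) (past e 0 \<omega>)) \<longlonglongrightarrow> 0"
      using AE_osc[of 0] by eventually_elim (simp add: rat_modulus_tendsto_zero del: of_nat_Suc)
    show "AE \<omega> in M. \<bar>osc (1 / real (Suc i)) (past e 0 \<omega>)\<bar> \<le> osc 2 (past e 0 \<omega>)" for i
      using AE_osc[of 0]
    proof eventually_elim
      case (elim \<omega>)
      have "rat_modulus (\<lambda>u. du Y 0 u \<omega>) (1 / real (Suc i)) \<le> rat_modulus (\<lambda>u. du Y 0 u \<omega>) 2"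
        using elim by (intro rat_modulus_le rat_modulus_nonneg rat_modulus_ge) auto
      then show ?case using elim rat_modulus_nonneg by simp
    qed
    obtain B where B: "0 \<le> B" "Lq_norm M q (\<lambda>\<omega>. SUP u\<in>{0..1}. \<bar>du Y 0 u \<omega>\<bar>) \<le> ennreal B"
      using sup by (cases "Lq_norm M q (\<lambda>\<omega>. SUP u\<in>{0..1}. \<bar>du Y 0 u \<omega>\<bar>)") auto
    \<comment> \<open>The supremum is not known to be measurable, so it is compared with half of
      \<open>osc 2\<close>, and the factor 2 is applied afterwards to the measurable side.\<close>
    have "AE \<omega> in M. \<bar>1 / 2 * osc 2 (past e 0 \<omega>)\<bar> \<le> \<bar>SUP u\<in>{0..1}. \<bar>du Y 0 u \<omega>\<bar>\<bar>"
      using AE_osc[of 0]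
    proof eventually_elim
      case (elim \<omega>)
      let ?s = "SUP u\<in>{0..1}. \<bar>du Y 0 u \<omega>\<bar>"
      have s: "\<bar>du Y 0 r \<omega>\<bar> \<le> ?s" if "r \<in> {0..1}" for r using elim that by (intro sup_du_ge) auto
      have "0 \<le> ?s" using s[of 0] by simp
      then have "rat_modulus (\<lambda>u. du Y 0 u \<omega>) 2 \<le> 2 * ?s"
      proof (intro rat_modulus_le)
        fix r r' :: real assume "r \<in> {0..1}" "r' \<in> {0..1}"
        then show "\<bar>du Y 0 r \<omega> - du Y 0 r' \<omega>\<bar> \<le> 2 * ?s" using s[of r] s[of r'] by linarith
      qed simp
      moreover have "osc 2 (past e 0 \<omega>) = rat_modulus (\<lambda>u. du Y 0 u \<omega>) 2" using elim by blast
      ultimately show ?case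
        using osc_nonneg[of 2 "past e 0 \<omega>"] by linarith
    qed
    from Lq_norm_mono_AE[OF q0 this B]
    have "Lq_norm M q (\<lambda>\<omega>. 1 / 2 * osc 2 (past e 0 \<omega>)) \<le> ennreal B" .
    then have "Lq_norm M q (\<lambda>\<omega>. 2 * (1 / 2 * osc 2 (past e 0 \<omega>))) \<le> ennreal (\<bar>2\<bar> * B)"
      using q B by (intro Lq_norm_cmult) auto
    then show "Lq_norm M q (\<lambda>\<omega>. osc 2 (past e 0 \<omega>)) < \<infinity>"
      by (simp add: le_less_trans[OF _ ennreal_less_top])
  qed (use q assms in auto)
  then obtain N where "Lq_norm M q (\<lambda>\<omega>. osc (1 / real (Suc N)) (past e 0 \<omega>)) \<le> ennreal \<epsilon>" by blast
  then have "Lq_norm past_law q (osc (1 / real (Suc N))) \<le> ennreal \<epsilon>"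
    unfolding Lq_norm_past[OF measurable_osc] .
  then show ?thesis by (intro exI[of _ "1 / real (Suc N)"]) simp
qed

lemma D_diff_le:
  assumes osc: "Lq_norm past_law q (osc \<delta>) \<le> ennreal \<epsilon>" and "0 \<le> \<epsilon>"
    and us: "u \<in> {0..1}" "s \<in> {0..1}" "\<bar>u - s\<bar> < \<delta>"
  shows "Lq_norm past_law q (\<lambda>x. D u x - D s x) \<le> ennreal \<epsilon>"
proof -
  have "AE \<omega> in M. \<bar>D u (past e 0 \<omega>) - D s (past e 0 \<omega>)\<bar> \<le> \<bar>osc \<delta> (past e 0 \<omega>)\<bar>"
    using du_eq[OF us(1), of 0] du_eq[OF us(2), of 0] AE_osc[of 0]
  proof eventually_elim
    case (elim \<omega>)
    then show ?case using rat_modulus_ge[OF _ us, of "\<lambda>u. du Y 0 u \<omega>"] by simp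
  qed
  from Lq_norm_mono_AE[OF q0 this \<open>0 \<le> \<epsilon>\<close>]
  have "Lq_norm M q (\<lambda>\<omega>. D u (past e 0 \<omega>) - D s (past e 0 \<omega>)) \<le> ennreal \<epsilon>"
    using osc Lq_norm_past[OF measurable_osc, of q \<delta> 0] by simp
  then show ?thesis
    using Lq_norm_past[of "\<lambda>x. D u x - D s x" q 0] us D_measurable by simp
qed

text \<open>The mean value bound holds path by path with the modulus of the path;
  \<open>AE_osc\<close> replaces it by \<open>osc\<close> at the past, whose norm does not depend on
  \<open>t\<close>.\<close>

lemma remainder_le:
  assumes osc: "Lq_norm past_law q (osc \<delta>) \<le> ennreal \<epsilon>" and "0 \<le> \<epsilon>"
    and uv: "u \<in> {0..1}" "v \<in> {0..1}" "\<bar>v - u\<bar> < \<delta>"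
  shows "Lq_norm M q (\<lambda>\<omega>. Y t v \<omega> - Y t u \<omega> - (v - u) * D u (past e t \<omega>)) \<le> ennreal (\<bar>v - u\<bar> * \<epsilon>)"
proof -
  have "AE \<omega> in M. \<bar>Y t v \<omega> - Y t u \<omega> - (v - u) * D u (past e t \<omega>)\<bar> \<le> \<bar>\<bar>v - u\<bar> * osc \<delta> (past e t \<omega>)\<bar>"
    using du_eq[OF uv(1), of t] AE_osc[of t]
  proof eventually_elim
    case (elim \<omega>)
    let ?d = "\<lambda>x. du Y t x \<omega>"
    have "\<bar>Y t v \<omega> - Y t u \<omega> - (v - u) * ?d u\<bar> \<le> \<bar>v - u\<bar> * rat_modulus ?d \<delta>"
    proof (rule derivative_remainder_le[OF _ uv])
      show "((\<lambda>v. Y t v \<omega>) has_vector_derivative ?d x) (at x within {0..1})" if "x \<in> {0..1}" for x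
        using elim that unfolding du_def differentiable_on_def by (simp add: vector_derivative_works)
      show "\<bar>?d s - ?d u\<bar> \<le> rat_modulus ?d \<delta>" if "s \<in> {0..1}" "\<bar>s - u\<bar> < \<delta>" for s
        using elim that uv by (intro rat_modulus_ge) auto
    qed
    then show ?case using elim by (simp add: abs_mult rat_modulus_nonneg)
  qed
  moreover have "Lq_norm M q (\<lambda>\<omega>. \<bar>v - u\<bar> * osc \<delta> (past e t \<omega>)) \<le> ennreal (\<bar>\<bar>v - u\<bar>\<bar> * \<epsilon>)"
    using q osc \<open>0 \<le> \<epsilon>\<close> by (intro Lq_norm_cmult) (simp_all add: Lq_norm_past[OF measurable_osc])
  ultimately show ?thesis
    using Lq_norm_mono_AE[OF q0, where f = "\<lambda>\<omega>. Y t v \<omega> - Y t u \<omega> - (v - u) * D u (past e t \<omega>)"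
        and g = "\<lambda>\<omega>. \<bar>v - u\<bar> * osc \<delta> (past e t \<omega>)" and M = M and c = "\<bar>v - u\<bar> * \<epsilon>"] \<open>0 \<le> \<epsilon>\<close> by simp
qed

definition D_mean :: "real \<Rightarrow> real" where
  "D_mean u = (LINT x|past_law. D u x)"

lemma D_measurable_law: "u \<in> {0..1} \<Longrightarrow> D u \<in> borel_measurable past_law"
  using D_measurable[of u] by (simp cong: measurable_cong_sets)

lemma D_mean_diff_le:
  assumes us: "u \<in> {0..1}" "s \<in> {0..1}" and "0 \<le> c"
    and le: "Lq_norm past_law q (\<lambda>x. D u x - D s x) \<le> ennreal c"
  shows "\<bar>D_mean u - D_mean s\<bar> \<le> 2 * c"
proof -
  interpret L: prob_space past_law by (rule prob_space_past_law)
  obtain B where "0 \<le> B" "\<And>u. u \<in> {0..1} \<Longrightarrow> Lq_norm past_law q (D u) \<le> ennreal B"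
    using D_bounded by blast
  then have "integrable past_law (D u)" if "u \<in> {0..1}" for u
    using that by (intro L.Lq_norm_expectation(1)[OF q1 D_measurable_law]) auto
  then have "D_mean u - D_mean s = (LINT x|past_law. D u x - D s x)"
    using us by (simp add: D_mean_def)
  then show ?thesis
    using L.Lq_norm_expectation(2)[OF q1 _ \<open>0 \<le> c\<close> le] us
    by (simp add: borel_measurable_diff D_measurable_law)
qed

lemma D_mean_le:
  assumes "0 \<le> B" "Lq_norm past_law q (D u) \<le> ennreal B" "u \<in> {0..1}"
  shows "\<bar>D_mean u\<bar> \<le> 2 * B"
  unfolding D_mean_def
  using assms by (intro prob_space.Lq_norm_expectation(2)[OF prob_space_past_law q1 D_measurable_law])

text \<open>Uniformity in \<open>u\<close> comes from \<open>L\<^sup>q\<close>-continuity of \<open>u \<mapsto> D u\<close> and a finite grid.\<close>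

lemma averages_D_small:
  assumes "0 < S" "0 < \<epsilon>"
  shows "\<exists>\<eta>>0. \<forall>u\<in>{0..1}. averages_le q (\<lambda>x. D u x - D_mean u) S \<eta> \<epsilon>"
proof -
  \<comment> \<open>Moving from \<open>u\<close> to a grid point costs \<open>\<epsilon>'\<close>
    for the derivative and \<open>2 * \<epsilon>'\<close> for its mean. Multiplied by the mass
    \<open>S\<close> this is \<open>\<epsilon> / 2\<close>; the other half is left for the averages
    at the grid points.\<close>
  define \<epsilon>' where "\<epsilon>' = \<epsilon> / (6 * S)"
  have "0 < \<epsilon>'" using assms by (simp add: \<epsilon>'_def)
  from osc_small[OF this] obtain \<delta> where \<delta>: "0 < \<delta>" "Lq_norm past_law q (osc \<delta>) \<le> ennreal \<epsilon>'" by blast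
  obtain N where N: "1 / real (Suc N) < \<delta>" using \<open>0 < \<delta>\<close> nat_approx_posE by blast
  define g where "g j = real j / real (Suc N)" for j
  have g01: "g j \<in> {0..1}" if "j \<le> Suc N" for j
    using that by (simp add: g_def divide_le_eq del: of_nat_Suc)
  obtain B where B: "0 \<le> B" "\<And>u. u \<in> {0..1} \<Longrightarrow> Lq_norm past_law q (D u) \<le> ennreal B"
    using D_bounded by blast
  have "\<exists>\<eta>>0. averages_le q (\<lambda>x. D (g j) x - D_mean (g j)) S \<eta> (\<epsilon> / 2)" if "j \<le> Suc N" for j
  proof -
    have "Lq_norm past_law q (D (g j)) < \<infinity>"
      using le_less_trans[OF B(2)[OF g01[OF that]] ennreal_less_top] by simp
    then have "averages_vanish q (\<lambda>x. D (g j) x - D_mean (g j))"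
      unfolding D_mean_def by (intro averages_vanish_centered q D_measurable g01 that)
    then show ?thesis using averages_vanishD assms half_gt_zero by metis
  qed
  then obtain \<eta> where \<eta>: "\<And>j. j \<le> Suc N \<Longrightarrow> 0 < \<eta> j"
    "\<And>j. j \<le> Suc N \<Longrightarrow> averages_le q (\<lambda>x. D (g j) x - D_mean (g j)) S (\<eta> j) (\<epsilon> / 2)" by metis
  define \<eta>0 where "\<eta>0 = Min (\<eta> ` {..Suc N})"
  have "0 < \<eta>0" unfolding \<eta>0_def using \<eta>(1) by (subst Min_gr_iff) auto
  have "averages_le q (\<lambda>x. D u x - D_mean u) S \<eta>0 \<epsilon>" if u: "u \<in> {0..1}" for u
  proof (rule averages_leI)
    fix T :: "int set" and w :: "int \<Rightarrow> real"
    assume T: "finite T" "(\<Sum>t\<in>T. \<bar>w t\<bar>) \<le> S" "\<forall>t\<in>T. \<bar>w t\<bar> \<le> \<eta>0"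
    \<comment> \<open>The left grid neighbor of \<open>u\<close>; for \<open>u = 1\<close> it is the
      last index \<open>Suc N\<close>.\<close>
    define j where "j = nat \<lfloor>u * real (Suc N)\<rfloor>"
    have "real j \<le> u * real (Suc N)" "u * real (Suc N) < real j + 1"
      using u by (simp_all add: j_def del: of_nat_Suc)
    then have "g j \<le> u" "u < g j + 1 / real (Suc N)"
      unfolding g_def by (simp_all add: divide_le_eq less_divide_eq add_divide_distrib[symmetric] del: of_nat_Suc)
    moreover have j: "j \<le> Suc N"
    proof -
      have "u * real (Suc N) \<le> 1 * real (Suc N)" using u by (intro mult_right_mono) auto
      from order_trans[OF \<open>real j \<le> u * real (Suc N)\<close> this]
      have "real j \<le> real (Suc N)" by (simp only: mult_1)
      then show ?thesis by simp
    qed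
    ultimately have "Lq_norm past_law q (\<lambda>x. D u x - D (g j) x) \<le> ennreal \<epsilon>'"
      using N \<open>0 < \<epsilon>'\<close> by (intro D_diff_le[OF \<delta>(2)] u g01) auto
    note dD = this
    define Z where "Z x = (D u x - D (g j) x) + (D_mean (g j) - D_mean u)" for x
    have [measurable]: "D u \<in> borel_measurable past_space" "D (g j) \<in> borel_measurable past_space"
      using u j by (auto intro: D_measurable g01)
    have [measurable]: "Z \<in> borel_measurable past_space" unfolding Z_def[abs_def] by measurable
    have "Lq_norm past_law q Z \<le> ennreal (\<epsilon>' + 2 * \<epsilon>')"
      unfolding Z_def[abs_def]
    proof (rule Lq_norm_add[OF q1])
      have "\<bar>D_mean (g j) - D_mean u\<bar> \<le> 2 * \<epsilon>'"
        using D_mean_diff_le[OF u g01[OF j] _ dD] \<open>0 < \<epsilon>'\<close> by (simp add: abs_minus_commute)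
      then show "Lq_norm past_law q (\<lambda>_. D_mean (g j) - D_mean u) \<le> ennreal (2 * \<epsilon>')"
        using q by (intro order_trans[OF prob_space.Lq_norm_const[OF prob_space_past_law] ennreal_leI]) auto
    qed (use dD \<open>0 < \<epsilon>'\<close> in \<open>simp_all cong: measurable_cong_sets\<close>)
    then have "Lq_norm M q (\<lambda>\<omega>. Z (past e t \<omega>)) \<le> ennreal (3 * \<epsilon>')" for t
      using Lq_norm_past[of Z q t] by simp
    then have "Lq_norm M q (\<lambda>\<omega>. \<Sum>t\<in>T. w t * Z (past e t \<omega>)) \<le> ennreal (S * (3 * \<epsilon>'))"
      using T \<open>0 < \<epsilon>'\<close> by (intro Lq_norm_weighted_sum q1) auto
    moreover have "Lq_norm M q (\<lambda>\<omega>. \<Sum>t\<in>T. w t * (D (g j) (past e t \<omega>) - D_mean (g j))) \<le> ennreal (\<epsilon> / 2)"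
    proof (rule averages_leD[OF \<eta>(2)[OF j] T(1,2)])
      have "\<eta>0 \<le> \<eta> j" unfolding \<eta>0_def using j by (intro Min_le) auto
      then show "\<forall>t\<in>T. \<bar>w t\<bar> \<le> \<eta> j" using T(3) by force
    qed
    ultimately have "Lq_norm M q (\<lambda>\<omega>. (\<Sum>t\<in>T. w t * (D (g j) (past e t \<omega>) - D_mean (g j)))
        + (\<Sum>t\<in>T. w t * Z (past e t \<omega>))) \<le> ennreal (\<epsilon> / 2 + S * (3 * \<epsilon>'))"
      using assms \<open>0 < \<epsilon>'\<close> by (intro Lq_norm_add q1) auto
    moreover have "\<epsilon> / 2 + S * (3 * \<epsilon>') = \<epsilon>" using assms by (simp add: \<epsilon>'_def)
    moreover have "(\<Sum>t\<in>T. w t * (D (g j) (past e t \<omega>) - D_mean (g j))) + (\<Sum>t\<in>T. w t * Z (past e t \<omega>))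
        = (\<Sum>t\<in>T. w t * (D u (past e t \<omega>) - D_mean u))" for \<omega>
      unfolding sum.distrib[symmetric] distrib_left[symmetric]
      by (intro sum.cong refl) (simp add: Z_def)
    ultimately show "Lq_norm M q (\<lambda>\<omega>. \<Sum>t\<in>T. w t * (D u (past e t \<omega>) - D_mean u)) \<le> ennreal \<epsilon>"
      by simp
  qed
  then show ?thesis using \<open>0 < \<eta>0\<close> by blast
qed

end

section \<open>Decomposition of the kernel bias\<close>

context smooth_past
begin

text \<open>Uniformity in \<open>u\<close> holds because the threshold on \<open>n\<close> only asks
  for \<open>b n < \<delta>\<close> and a lower bound on \<open>real n * b n\<close>. Four error
  terms receive \<open>\<epsilon> * b n / 5\<close> each.\<close>

lemma kernel_bias_small:
  fixes X :: "nat \<Rightarrow> nat \<Rightarrow> 'a \<Rightarrow> real" and K :: "real \<Rightarrow> real" and b :: "nat \<Rightarrow> real"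
  assumes X: "\<And>n t. t \<in> {1..n} \<Longrightarrow> X t n \<in> borel_measurable M"
    and XY: "\<And>n t. t \<in> {1..n} \<Longrightarrow>
        Lq_norm M q (\<lambda>\<omega>. X t n \<omega> - Y (int t) (real t / real n) \<omega>) \<le> ennreal (C / real n)"
    and "0 \<le> C"
    and V: "\<And>N x. mono_on {..N::nat} x \<Longrightarrow> (\<Sum>i<N. \<bar>K (x (Suc i)) - K (x i)\<bar>) \<le> V"
    and bnd: "\<And>x. \<bar>K x\<bar> \<le> \<kappa>"
    and supp: "\<And>x. K x \<noteq> 0 \<Longrightarrow> \<bar>x\<bar> \<le> 1 / 2"
    and even: "\<And>x. K (- x) = K x"
    and b0: "b \<longlonglongrightarrow> 0" and nb: "filterlim (\<lambda>n. real n * b n) at_top sequentially"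
    and "0 < \<epsilon>"
  shows "\<forall>\<^sub>F n in sequentially. 0 < b n \<and> (\<forall>u\<in>{b n / 2..1 - b n / 2}.
    Lq_norm M q (\<lambda>\<omega>. 1 / real n *
      (\<Sum>t=1..n. K_scaled K (b n) (real t / real n - u) * (X t n \<omega> - Y (int t) u \<omega>))) \<le> ennreal (\<epsilon> * b n))"
proof -
  have "0 \<le> \<kappa>" using bnd[of 0] by simp
  have "0 \<le> V" using V[of 0 "\<lambda>_. 0"] by (simp add: mono_on_def)
  \<comment> \<open>The absolute weights sum to at most
    \<open>\<kappa> * (N + 1) / N \<le> 2 * \<kappa>\<close> once \<open>N \<ge> 1\<close>; the
    added 1 makes \<open>S\<close> positive.\<close>
  define S where "S = 2 * \<kappa> + 1"
  have "0 < S" using \<open>0 \<le> \<kappa>\<close> by (simp add: S_def)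
  define \<epsilon>' where "\<epsilon>' = \<epsilon> / (5 * S)"
  have "0 < \<epsilon>'" using \<open>0 < \<epsilon>\<close> \<open>0 < S\<close> by (simp add: \<epsilon>'_def)
  obtain \<delta> where "0 < \<delta>" and osc: "Lq_norm past_law q (osc \<delta>) \<le> ennreal \<epsilon>'"
    using osc_small[OF \<open>0 < \<epsilon>'\<close>] by blast
  obtain \<eta> where "0 < \<eta>" and av: "\<And>u. u \<in> {0..1} \<Longrightarrow> averages_le q (\<lambda>x. D u x - D_mean u) S \<eta> (\<epsilon> / 5)"
    using averages_D_small[OF \<open>0 < S\<close>, of "\<epsilon> / 5"] \<open>0 < \<epsilon>\<close> by auto
  obtain B where "0 \<le> B" and B: "\<And>u. u \<in> {0..1} \<Longrightarrow> Lq_norm past_law q (D u) \<le> ennreal B"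
    using D_bounded by blast
  \<comment> \<open>One summand for each demand on \<open>N = real n * b n\<close>: that
    \<open>N \<ge> 1\<close>, that the largest weight \<open>\<kappa> / N\<close> is at most
    \<open>\<eta>\<close>, and that the bounds of \<open>T1\<close> and of \<open>T4\<close> fit
    their shares.\<close>
  define Z where "Z = 1 + \<kappa> / \<eta> + S * C * 5 / \<epsilon> + 2 * B * (V + 2 * \<kappa>) * 5 / \<epsilon>"
  have Z: "1 \<le> Z" "\<kappa> / \<eta> \<le> Z" "S * C * 5 / \<epsilon> \<le> Z" "2 * B * (V + 2 * \<kappa>) * 5 / \<epsilon> \<le> Z"
  proof -
    have "0 \<le> \<kappa> / \<eta>" "0 \<le> S * C * 5 / \<epsilon>" "0 \<le> 2 * B * (V + 2 * \<kappa>) * 5 / \<epsilon>"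
      using \<open>0 \<le> \<kappa>\<close> \<open>0 < \<eta>\<close> \<open>0 < S\<close> \<open>0 \<le> C\<close> \<open>0 < \<epsilon>\<close> \<open>0 \<le> B\<close> \<open>0 \<le> V\<close> by simp_all
    then show "1 \<le> Z" "\<kappa> / \<eta> \<le> Z" "S * C * 5 / \<epsilon> \<le> Z" "2 * B * (V + 2 * \<kappa>) * 5 / \<epsilon> \<le> Z"
      unfolding Z_def by linarith+
  qed
  have "\<forall>\<^sub>F n in sequentially. b n < \<delta>" using b0 \<open>0 < \<delta>\<close> by (rule order_tendstoD)
  moreover have "\<forall>\<^sub>F n in sequentially. Z \<le> real n * b n"
    using nb by (simp add: filterlim_at_top)
  ultimately show ?thesis
  proof eventually_elim
    case (elim n)
    define N where "N = real n * b n"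
    have "Z \<le> N" using elim by (simp add: N_def)
    then have "1 \<le> N" using Z by linarith
    then have "0 < real n * b n" by (simp add: N_def)
    then have "0 < real n" and "0 < b n" by (simp_all add: zero_less_mult_iff)
    have small: "c / N \<le> a" if "c / a \<le> Z" "0 < a" for c a
    proof -
      have "c / a \<le> N" using that \<open>Z \<le> N\<close> by linarith
      then show ?thesis using that \<open>1 \<le> N\<close> by (simp add: field_simps)
    qed
    have "Lq_norm M q (\<lambda>\<omega>. 1 / real n *
        (\<Sum>t=1..n. K_scaled K (b n) (real t / real n - u) * (X t n \<omega> - Y (int t) u \<omega>))) \<le> ennreal (\<epsilon> * b n)"
      if u: "b n / 2 \<le> u" "u \<le> 1 - b n / 2" for u
    proof -
      have u01: "u \<in> {0..1}" using u \<open>0 < b n\<close> by auto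
      define v where "v t = real t / real n" for t :: nat
      have v01: "v t \<in> {0..1}" if "t \<in> {1..n}" for t
        using that \<open>0 < real n\<close> by (simp add: v_def divide_le_eq)
      define y where "y t = (v t - u) / b n" for t
      \<comment> \<open>\<open>w\<close> is the scaled kernel divided by \<open>n\<close>. Factoring
        \<open>b n\<close> out of \<open>v t - u = b n * y t\<close> leaves \<open>g\<close> as the
        weights of the derivatives.\<close>
      define w where "w t = K (y t) / N" for t
      define g where "g t = y t * w t" for t
      define \<rho> where "\<rho> = \<epsilon> * b n / 5"
      have "0 < \<rho>" using \<open>0 < \<epsilon>\<close> \<open>0 < b n\<close> by (simp add: \<rho>_def)
      have wsum: "(\<Sum>t=1..n. \<bar>w t\<bar>) \<le> S"
      proof -
        have "(\<Sum>t=1..n. \<bar>w t\<bar>) = (\<Sum>t=1..n. \<bar>K (y t)\<bar>) / N"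
          using \<open>1 \<le> N\<close> by (simp add: w_def abs_divide sum_divide_distrib)
        also have "\<dots> \<le> \<kappa> * (N + 1) / N"
          using kernel_weight_sum_le[where n = n and u = u, OF bnd supp \<open>0 < b n\<close>] \<open>0 < real n\<close> \<open>1 \<le> N\<close>
          unfolding N_def y_def v_def by (intro divide_right_mono) auto
        also have "\<dots> = \<kappa> + \<kappa> / N" using \<open>1 \<le> N\<close> by (simp add: field_simps)
        also have "\<dots> \<le> S"
          using \<open>1 \<le> N\<close> \<open>0 \<le> \<kappa>\<close> mult_left_mono[of 1 N \<kappa>] by (simp add: S_def divide_le_eq field_simps)
        finally show ?thesis .
      qed
      have y12: "\<bar>y t\<bar> \<le> 1 / 2" if "w t \<noteq> 0" for t using that supp by (auto simp: w_def)
      have near: "\<bar>v t - u\<bar> \<le> b n / 2" if "w t \<noteq> 0" for t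
        using y12[OF that] \<open>0 < b n\<close> by (simp add: y_def abs_divide field_simps)
      have gw: "\<bar>g t\<bar> \<le> \<bar>w t\<bar>" for t
        using y12[of t] mult_right_mono[of "\<bar>y t\<bar>" 1 "\<bar>w t\<bar>"] by (cases "w t = 0") (auto simp: g_def abs_mult)
      have measY: "Y t u \<in> borel_measurable M" "Y t (v s) \<in> borel_measurable M" if "s \<in> {1..n}" for t s
        using Y_measurable u01 v01[OF that] by blast+
      have [measurable]: "(\<lambda>\<omega>. D u (past e t \<omega>)) \<in> borel_measurable M" for t
        using measurable_compose[OF measurable_past D_measurable[OF u01]] .
      \<comment> \<open>\<open>T1\<close>: array against its approximation at \<open>t / n\<close>;
        \<open>T2\<close>: Taylor remainders; \<open>b n * T3\<close>: centered derivatives;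
        \<open>T4\<close>: their mean.\<close>
      define T1 where "T1 \<omega> = (\<Sum>t=1..n. w t * (X t n \<omega> - Y (int t) (v t) \<omega>))" for \<omega>
      define R where "R t \<omega> = Y (int t) (v t) \<omega> - Y (int t) u \<omega> - (v t - u) * D u (past e (int t) \<omega>)" for t \<omega>
      define T2 where "T2 \<omega> = (\<Sum>t=1..n. w t * R t \<omega>)" for \<omega>
      define T3 where "T3 \<omega> = (\<Sum>t=1..n. g t * (D u (past e (int t) \<omega>) - D_mean u))" for \<omega>
      define T4 where "T4 = b n * D_mean u * (\<Sum>t=1..n. g t)"
      have measR: "R t \<in> borel_measurable M" if "t \<in> {1..n}" for t
        unfolding R_def[abs_def] using measY[OF that] by simp
      have measT: "T1 \<in> borel_measurable M" "T2 \<in> borel_measurable M" "T3 \<in> borel_measurable M"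
        unfolding T1_def[abs_def] T2_def[abs_def] T3_def[abs_def]
        using measY X measR by (auto intro!: borel_measurable_sum borel_measurable_times borel_measurable_diff)
      have T1: "Lq_norm M q T1 \<le> ennreal \<rho>"
      proof -
        have "Lq_norm M q T1 \<le> ennreal (S * (C / real n))"
          unfolding T1_def[abs_def] using X measY XY \<open>0 \<le> C\<close> wsum
          by (intro Lq_norm_weighted_sum q1) (auto simp: v_def)
        \<comment> \<open>An error of order \<open>1 / n\<close> is rewritten as \<open>b n\<close>
          times something of order \<open>1 / N\<close>.\<close>
        also have "S * (C / real n) = b n * (S * C / N)"
          using \<open>0 < b n\<close> by (simp add: N_def)
        also have "ennreal \<dots> \<le> ennreal (b n * (\<epsilon> / 5))"
          using Z(3) \<open>0 < \<epsilon>\<close> \<open>0 < b n\<close> by (intro ennreal_leI mult_left_mono small) (auto simp: mult_ac)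
        finally show ?thesis by (simp add: \<rho>_def mult.commute)
      qed
      have T2: "Lq_norm M q T2 \<le> ennreal \<rho>"
      proof -
        have "Lq_norm M q (R t) \<le> ennreal (b n * \<epsilon>')" if t: "t \<in> {1..n}" "w t \<noteq> 0" for t
        proof -
          have "\<bar>v t - u\<bar> < \<delta>" using near[OF t(2)] elim \<open>0 < b n\<close> by linarith
          then have "Lq_norm M q (R t) \<le> ennreal (\<bar>v t - u\<bar> * \<epsilon>')"
            unfolding R_def[abs_def] using \<open>0 < \<epsilon>'\<close> by (intro remainder_le[OF osc] u01 v01 t) auto
          also have "\<dots> \<le> ennreal (b n * \<epsilon>')"
            using near[OF t(2)] \<open>0 < b n\<close> \<open>0 < \<epsilon>'\<close> by (intro ennreal_leI mult_right_mono) auto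
          finally show ?thesis .
        qed
        then have "Lq_norm M q T2 \<le> ennreal (S * (b n * \<epsilon>'))"
          unfolding T2_def[abs_def] using measR wsum \<open>0 < b n\<close> \<open>0 < \<epsilon>'\<close>
          by (intro Lq_norm_weighted_sum q1) auto
        also have "S * (b n * \<epsilon>') = \<rho>" using \<open>0 < S\<close> by (simp add: \<rho>_def \<epsilon>'_def)
        finally show ?thesis .
      qed
      have T3: "Lq_norm M q (\<lambda>\<omega>. b n * T3 \<omega>) \<le> ennreal \<rho>"
      proof -
        have "\<bar>g t\<bar> \<le> \<eta>" for t
        proof -
          have "\<bar>g t\<bar> \<le> \<kappa> / N"
            using gw[of t] divide_right_mono[OF bnd[of "y t"], of N] \<open>1 \<le> N\<close> by (simp add: w_def abs_divide)
          also have "\<dots> \<le> \<eta>" using Z(2) \<open>0 < \<eta>\<close> by (rule small)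
          finally show ?thesis .
        qed
        moreover have "(\<Sum>t=1..n. \<bar>g t\<bar>) \<le> S"
          by (rule order_trans[OF sum_mono[OF gw] wsum])
        ultimately have "Lq_norm M q T3 \<le> ennreal (\<epsilon> / 5)"
          unfolding T3_def[abs_def] by (intro averages_leD_nat[OF av[OF u01]])
        then have "Lq_norm M q (\<lambda>\<omega>. b n * T3 \<omega>) \<le> ennreal (\<bar>b n\<bar> * (\<epsilon> / 5))"
          using measT(3) \<open>0 < \<epsilon>\<close> by (intro Lq_norm_cmult q0) auto
        then show ?thesis using \<open>0 < b n\<close> by (simp add: \<rho>_def mult.commute)
      qed
      have T4: "Lq_norm M q (\<lambda>_. T4) \<le> ennreal \<rho>"
      proof -
        have "(\<Sum>t=1..n. g t) = (\<Sum>t=1..n. y t * K (y t)) / N"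
          by (simp add: g_def w_def sum_divide_distrib)
        also have "\<bar>\<dots>\<bar> \<le> (V + 2 * \<kappa>) / N"
        proof -
          have "\<bar>\<Sum>t=1..n. y t * K (y t)\<bar> \<le> V + 2 * \<kappa>"
            unfolding y_def v_def using \<open>0 < b n\<close> \<open>1 \<le> N\<close> u
            by (intro kernel_first_moment_sum_bounded V bnd supp even) (auto simp: N_def)
          then show ?thesis using \<open>1 \<le> N\<close> by (simp add: abs_divide divide_right_mono)
        qed
        finally have gsum: "\<bar>\<Sum>t=1..n. g t\<bar> \<le> (V + 2 * \<kappa>) / N" .
        have "\<bar>T4\<bar> = b n * (\<bar>D_mean u\<bar> * \<bar>\<Sum>t=1..n. g t\<bar>)"
          using \<open>0 < b n\<close> by (simp add: T4_def abs_mult)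
        also have "\<dots> \<le> b n * (2 * B * ((V + 2 * \<kappa>) / N))"
          using gsum D_mean_le[OF \<open>0 \<le> B\<close> B[OF u01] u01] \<open>0 < b n\<close> \<open>0 \<le> B\<close>
          by (intro mult_left_mono mult_mono) auto
        also have "\<dots> = b n * (2 * B * (V + 2 * \<kappa>) / N)" by simp
        also have "\<dots> \<le> b n * (\<epsilon> / 5)"
          using Z(4) \<open>0 < \<epsilon>\<close> \<open>0 < b n\<close> by (intro mult_left_mono small) (auto simp: mult_ac)
        finally have "\<bar>T4\<bar> \<le> \<rho>" by (simp add: \<rho>_def mult.commute)
        then show ?thesis by (intro order_trans[OF Lq_norm_const[OF q0] ennreal_leI])
      qed
      have split: "1 / real n * (\<Sum>t=1..n. K_scaled K (b n) (real t / real n - u) * (X t n \<omega> - Y (int t) u \<omega>))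
          = (T1 \<omega> + T2 \<omega>) + (b n * T3 \<omega> + T4)" for \<omega>
      proof -
        have vy: "v t - u = b n * y t" for t using \<open>0 < b n\<close> by (simp add: y_def)
        have "1 / real n * (\<Sum>t=1..n. K_scaled K (b n) (real t / real n - u) * (X t n \<omega> - Y (int t) u \<omega>))
            = (\<Sum>t=1..n. w t * (X t n \<omega> - Y (int t) u \<omega>))"
          unfolding sum_distrib_left by (intro sum.cong) (simp_all add: K_scaled_def w_def y_def v_def N_def)
        also have "\<dots> = (\<Sum>t=1..n. (w t * (X t n \<omega> - Y (int t) (v t) \<omega>) + w t * R t \<omega>)
            + (b n * (g t * (D u (past e (int t) \<omega>) - D_mean u)) + b n * D_mean u * g t))"
          by (intro sum.cong refl) (simp add: R_def vy g_def algebra_simps)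
        also have "\<dots> = (T1 \<omega> + T2 \<omega>) + (b n * T3 \<omega> + T4)"
          by (simp only: T1_def T2_def T3_def T4_def sum.distrib sum_distrib_left)
        finally show ?thesis .
      qed
      have "Lq_norm M q (\<lambda>\<omega>. (T1 \<omega> + T2 \<omega>) + (b n * T3 \<omega> + T4)) \<le> ennreal ((\<rho> + \<rho>) + (\<rho> + \<rho>))"
        using measT T1 T2 T3 T4 \<open>0 < \<rho>\<close>
        by (intro Lq_norm_add q1 borel_measurable_add borel_measurable_times borel_measurable_const add_nonneg_nonneg)
          simp_all
      also have "\<dots> \<le> ennreal (\<epsilon> * b n)"
        using \<open>0 < \<epsilon>\<close> \<open>0 < b n\<close> by (intro ennreal_leI) (simp add: \<rho>_def)
      finally show ?thesis unfolding split .
    qed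
    then show ?case using \<open>0 < b n\<close> by auto
  qed
qed

end

theorem proposition3p6:
  fixes M :: "'a measure"
    and X :: "nat \<Rightarrow> nat \<Rightarrow> 'a \<Rightarrow> real"
    and Y :: "int \<Rightarrow> real \<Rightarrow> 'a \<Rightarrow> real"
    and e e' :: "int \<Rightarrow> 'a \<Rightarrow> real"
    and q \<alpha> C :: real
    and K :: "real \<Rightarrow> real"
    and b :: "nat \<Rightarrow> real"
  assumes "model M X Y"
    and "innovations M e e'"
    and "q \<ge> 2"
    and "cond_S1 M q \<alpha> C X Y"
    and "cond_S2 M q Y"
    and "cond_S3 M q \<alpha> Y"
    and "cond_M3 M e e' q Y"
    and "kernel_assumption K"
    and "\<And>x. K (- x) = K x"
    and "b \<longlonglongrightarrow> 0"
    and "filterlim (\<lambda>n. real n * b n) at_top sequentially"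
  shows "\<exists>f g :: nat \<Rightarrow> real. f \<in> o(b) \<and> g \<in> O(\<lambda>n. 1 / real n) \<and>
    (\<forall>\<^sub>F n in sequentially. 0 \<le> f n + g n \<and>
      (SUP u\<in>{b n / 2..1 - b n / 2}.
         Lq_norm M q (\<lambda>\<omega>. 1 / real n *
           (\<Sum>t=1..n. K_scaled K (b n) (real t / real n - u) * (X t n \<omega> - Y (int t) u \<omega>))))
      = ennreal (f n + g n))"
proof -
  interpret prob_space M using assms(1) by (simp add: model_def)
  obtain H DH where
    DH: "\<And>u. u \<in> {0..1} \<Longrightarrow> DH u \<in> borel_measurable past_space"
      "\<And>u t. u \<in> {0..1} \<Longrightarrow> AE \<omega> in M.
           ((\<lambda>v. H v (past e t \<omega>)) has_real_derivative DH u (past e t \<omega>)) (at u within {0..1}) \<and>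
           du Y t u \<omega> = DH u (past e t \<omega>)"
    using assms(7) unfolding cond_M3_def by blast
  interpret smooth_past M e q Y DH
  proof
    show "indep_vars (\<lambda>_. borel) e UNIV" "distr M borel (e t) = distr M borel (e 1)" for t
      using assms(2) unfolding innovations_def by blast+
    show "Y t u \<in> borel_measurable M" if "u \<in> {0..1}" for t u
      using assms(1) that unfolding model_def by blast
    show "AE \<omega> in M. du Y t u \<omega> = DH u (past e t \<omega>)" if "u \<in> {0..1}" for t u
      using DH(2)[OF that, of t] by eventually_elim simp
    show "AE \<omega> in M. (\<lambda>v. Y t v \<omega>) differentiable_on {0..1} \<and> continuous_on {0..1} (\<lambda>u. du Y t u \<omega>)"
      "Lq_norm M q (\<lambda>\<omega>. SUP u\<in>{0..1}. \<bar>du Y 0 u \<omega>\<bar>) < \<infinity>" for t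
      using assms(6) unfolding cond_S3_def by blast+
  qed (use assms(3) DH(1) in auto)
  have X: "X t n \<in> borel_measurable M" if "t \<in> {1..n}" for t n
    using assms(1) that unfolding model_def by blast
  have "\<alpha> = 1" using assms(6) by (simp add: cond_S3_def)
  have "0 < C" using assms(4) by (simp add: cond_S1_def)
  have S1: "Lq_norm M q (\<lambda>\<omega>. X t n \<omega> - Y (int t) (real t / real n) \<omega>)
      \<le> ennreal (C * real n powr - 1)" if "t \<in> {1..n}" for t n
    using assms(4) that \<open>\<alpha> = 1\<close> unfolding cond_S1_def by blast
  have XY: "Lq_norm M q (\<lambda>\<omega>. X t n \<omega> - Y (int t) (real t / real n) \<omega>) \<le> ennreal (C / real n)"
    if "t \<in> {1..n}" for t n
    using S1[OF that] that by (simp add: powr_neg_one)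
  obtain \<kappa> where \<kappa>: "\<And>x. \<bar>K x\<bar> \<le> \<kappa>"
    using assms(8) unfolding kernel_assumption_def bounded_iff by auto
  obtain V where V: "\<And>N x. mono_on {..N::nat} x \<Longrightarrow> (\<Sum>i<N. \<bar>K (x (Suc i)) - K (x i)\<bar>) \<le> V"
    using assms(8) unfolding kernel_assumption_def bounded_variation_def by blast
  have supp: "\<bar>x\<bar> \<le> 1 / 2" if "K x \<noteq> 0" for x
  proof -
    have "x \<in> {-1/2..1/2}" using assms(8) that unfolding kernel_assumption_def by blast
    then show ?thesis by auto
  qed
  define F where "F n = (SUP u\<in>{b n / 2..1 - b n / 2}. Lq_norm M q (\<lambda>\<omega>. 1 / real n *
      (\<Sum>t=1..n. K_scaled K (b n) (real t / real n - u) * (X t n \<omega> - Y (int t) u \<omega>))))" for n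
  have F: "\<forall>\<^sub>F n in sequentially. 0 < b n \<and> F n \<le> ennreal (c * b n)" if "0 < c" for c
  proof -
    have "\<forall>\<^sub>F n in sequentially. 0 < b n \<and> (\<forall>u\<in>{b n / 2..1 - b n / 2}.
        Lq_norm M q (\<lambda>\<omega>. 1 / real n *
          (\<Sum>t=1..n. K_scaled K (b n) (real t / real n - u) * (X t n \<omega> - Y (int t) u \<omega>))) \<le> ennreal (c * b n))"
      by (rule kernel_bias_small[where C = C and V = V and \<kappa> = \<kappa>])
        (use X XY \<open>0 < C\<close> V \<kappa> supp assms(9-11) that in simp_all)
    then show ?thesis
      unfolding F_def by eventually_elim (intro conjI SUP_least; elim conjE; (drule (1) bspec)?; assumption)
  qed
  \<comment> \<open>Eventually \<open>F n\<close> is finite, so \<open>enn2real\<close> loses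
    nothing. All of the error goes into \<open>f\<close>, and the witness for the
    \<open>1 / n\<close> part is 0.\<close>
  define f where "f n = enn2real (F n)" for n
  have "f \<in> o(b)"
  proof (rule landau_o.smallI)
    fix c :: real assume "0 < c"
    from F[OF this] show "\<forall>\<^sub>F n in sequentially. norm (f n) \<le> c * norm (b n)"
      by eventually_elim (use \<open>0 < c\<close> in \<open>simp add: f_def enn2real_leI\<close>)
  qed
  moreover have "\<forall>\<^sub>F n in sequentially. 0 \<le> f n + 0 \<and> F n = ennreal (f n + 0)"
    using F[OF zero_less_one]
  proof eventually_elim
    case (elim n)
    then have "F n < top" using le_less_trans[OF _ ennreal_less_top] by blast
    then show ?case by (simp add: f_def)
  qed
  moreover have "(\<lambda>_. 0) \<in> O(\<lambda>n. 1 / real n)" by simp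
  ultimately show ?thesis unfolding F_def by (intro exI[of _ f] exI[of _ "\<lambda>_. 0"]) simp
qed

end
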